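(* For every compact abelian group $G$ and every finite set $D\subset G\setminus\{0\}$ with $|D|\le 3$, the Motzkin density $\mathrm{Md}_G(D)$ is a rational number.
   Context: Compact abelian groups are Hausdorff; $\mu$ denotes the Haar probability measure on $G$. For $D\subset G$, a set $A\subset G$ is $D$-avoiding if $(A-A)\cap D=\emptyset$. The Motzkin density is $\mathrm{Md}_G(D)=\sup\{\mu(A): A\subset G \text{ Borel},\ (A-A)\cap D=\emptyset\}$. *)

theory Defs
  imports "HOL-Analysis.Analysis" "HOL-Probability.Probability"
begin

definition haar_prob :: "'a::{topological_ab_group_add,t2_space} measure \<Rightarrow> bool" where
  "haar_prob \<mu> \<longleftrightarrow>
     prob_space \<mu> \<and> sets \<mu> = sets borel \<and>
     (\<forall>x. \<forall>A\<in>sets borel. emeasure \<mu> ((\<lambda>y. x + y) ` A) = emeasure \<mu> A) \<and>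
     (\<forall>A\<in>sets borel. emeasure \<mu> A = (INF U\<in>{U. open U \<and> A \<subseteq> U}. emeasure \<mu> U)) \<and>
     (\<forall>U. open U \<longrightarrow> emeasure \<mu> U = (SUP K\<in>{K. compact K \<and> K \<subseteq> U}. emeasure \<mu> K))"

definition avoiding :: "'a::ab_group_add set \<Rightarrow> 'a set \<Rightarrow> bool" where
  "avoiding D A \<longleftrightarrow> (\<forall>x\<in>A. \<forall>y\<in>A. x - y \<notin> D)"

definition motzkin_density :: "'a::{topological_ab_group_add,t2_space} measure \<Rightarrow> 'a set \<Rightarrow> real" where
  "motzkin_density \<mu> D = Sup {measure \<mu> A | A. A \<in> sets borel \<and> avoiding D A}"

end

theory Submission
  imports Defs "HOL-Combinatorics.Permutations" "HOL-Number_Theory.Cong" "HOL-Real_Asymp.Real_Asymp"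
begin

text \<open>
  Averaging over translates shows that \<open>card F * Md(D)\<close> is at most the size of the largest
  \<open>D\<close>-avoiding subset of a finite set \<open>F\<close>; conversely a randomised local rule turns a finite
  \<open>D\<close>-avoiding set \<open>I\<close> into Borel \<open>D\<close>-avoiding sets of measure \<open>card I / card F\<close>, for any finite
  \<open>F\<close> containing \<open>I\<close>, \<open>I + D\<close> and \<open>I - D\<close>. So the density only depends on the group generated
  by \<open>D\<close>, hence on the lattice of integer relations between the elements of \<open>D\<close>.
  If all relations have even coefficient sum, parity makes the Cayley graph bipartite and the
  density is \<open>1/2\<close>. If all relations are proportional and some are odd, the shortest odd relation is
  an odd cycle of length \<open>n\<close>, and the sum of the coefficients, signed as in that relation, is a
  homomorphism to \<open>\<int>/n\<close>; so the density is \<open>(n - 1)/(2n)\<close>. Otherwise, since \<open>card D \<le> 3\<close>,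
  the group generated by \<open>D\<close> is either finite, and the density is a quotient of cardinalities, or
  virtually cyclic, and the density is a rational multiple of a maximal cycle mean in a finite
  graph.
\<close>

section \<open>Borel avoiding sets from finite ones\<close>

definition argmin_permutations :: "'a::linorder set \<Rightarrow> 'a set \<Rightarrow> 'a \<Rightarrow> ('a \<Rightarrow> 'a) set" where
  "argmin_permutations A J i = {\<sigma>. \<sigma> permutes A \<and> (\<forall>j\<in>J. \<sigma> i \<le> \<sigma> j)}"

lemma finite_argmin_permutations: "finite A \<Longrightarrow> finite (argmin_permutations A J i)"
  by (rule finite_subset[OF _ finite_permutations]) (auto simp: argmin_permutations_def)

lemma card_argmin_permutations_le:
  assumes "finite A" "J \<subseteq> A" and ab: "a \<in> J" "b \<in> J"
  shows "card (argmin_permutations A J a) \<le> card (argmin_permutations A J b)"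
proof (rule card_inj_on_le)
  let ?t = "Transposition.transpose a b"
  show "inj_on (\<lambda>\<sigma>. \<sigma> \<circ> ?t) (argmin_permutations A J a)"
    by (rule inj_onI) (metis comp_assoc comp_id transpose_comp_involutory)
  have "?t permutes A"
    using ab assms(2) by (intro permutes_swap_id) auto
  moreover have "?t x \<in> J" if "x \<in> J" for x
    using ab that by (auto simp: Transposition.transpose_def)
  ultimately show "(\<lambda>\<sigma>. \<sigma> \<circ> ?t) ` argmin_permutations A J a \<subseteq> argmin_permutations A J b"
    by (auto simp: argmin_permutations_def intro: permutes_compose)
qed (use assms in \<open>simp add: finite_argmin_permutations\<close>)

lemma disjoint_argmin_permutations:
  assumes "i \<in> J" "j \<in> J" "i \<noteq> j"
  shows "argmin_permutations A J i \<inter> argmin_permutations A J j = {}"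
proof (rule ccontr)
  assume "argmin_permutations A J i \<inter> argmin_permutations A J j \<noteq> {}"
  then obtain \<sigma> where "\<sigma> permutes A" "\<sigma> i = \<sigma> j"
    using assms by (auto simp: argmin_permutations_def intro: antisym)
  then show False using assms(3) by (metis permutes_inj injD)
qed

lemma UN_argmin_permutations:
  assumes "finite J" "J \<noteq> {}"
  shows "(\<Union>j\<in>J. argmin_permutations A J j) = {\<sigma>. \<sigma> permutes A}"
proof -
  have "\<exists>i\<in>J. \<forall>j\<in>J. \<sigma> i \<le> \<sigma> j" for \<sigma> :: "'a \<Rightarrow> 'a"
    using ex_is_arg_min_if_finite[OF assms, of \<sigma>] by (auto simp: is_arg_min_linorder)
  then show ?thesis by (auto simp: argmin_permutations_def)
qed

lemma card_UN_argmin_permutations: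
  assumes A: "finite A" "J \<subseteq> A" and "I \<subseteq> J"
  shows "card J * card (\<Union>i\<in>I. argmin_permutations A J i) = card I * fact (card A)"
proof (cases "J = {}")
  case False
  then obtain j where j: "j \<in> J" by blast
  have UN: "card (\<Union>i\<in>K. argmin_permutations A J i) = card K * card (argmin_permutations A J j)"
    if K: "K \<subseteq> J" for K
  proof -
    have "finite K" using K A by (meson finite_subset)
    then have "card (\<Union>i\<in>K. argmin_permutations A J i) = (\<Sum>i\<in>K. card (argmin_permutations A J i))"
      using K A(1) by (intro card_UN_disjoint ballI impI finite_argmin_permutations
        disjoint_argmin_permutations) auto
    also have "\<dots> = (\<Sum>i\<in>K. card (argmin_permutations A J j))"
      using K j by (intro sum.cong antisym card_argmin_permutations_le A) auto
    finally show ?thesis by simp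
  qed
  have "fact (card A) = card (\<Union>i\<in>J. argmin_permutations A J i)"
    using A False by (simp add: UN_argmin_permutations finite_subset card_permutations)
  also have "\<dots> = card J * card (argmin_permutations A J j)"
    by (rule UN) simp
  finally show ?thesis using UN[OF assms(3)] by simp
qed (use assms in simp)

lemma card_eq_sum_indicator:
  "finite J \<Longrightarrow> real (card {j\<in>J. x \<in> B j}) = (\<Sum>j\<in>J. indicat_real (B j) x)"
  by (simp add: indicator_def sum.If_cases Int_def)

lemma (in finite_measure) integrable_card_sets:
  assumes "finite J" "\<And>j. j \<in> J \<Longrightarrow> B j \<in> sets M"
  shows "integrable M (\<lambda>x. real (card {j\<in>J. x \<in> B j}))"
  using assms by (simp add: card_eq_sum_indicator integrable_indicator_iff emeasure_eq_measure)

lemma (in finite_measure) sum_measure_eq_integral_card: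
  assumes "finite J" "\<And>j. j \<in> J \<Longrightarrow> B j \<in> sets M"
  shows "(\<Sum>j\<in>J. measure M (B j)) = (\<integral>x. real (card {j\<in>J. x \<in> B j}) \<partial>M)"
proof -
  have "(\<Sum>j\<in>J. measure M (B j)) = (\<Sum>j\<in>J. (\<integral>x. indicat_real (B j) x \<partial>M))"
    using assms(2) by (intro sum.cong) (simp_all add: Int_absorb2 sets.sets_into_space)
  also have "\<dots> = (\<integral>x. (\<Sum>j\<in>J. indicat_real (B j) x) \<partial>M)"
    using assms(2) by (intro Bochner_Integration.integral_sum[symmetric])
      (simp add: integrable_indicator_iff emeasure_eq_measure)
  finally show ?thesis by (simp only: card_eq_sum_indicator[OF assms(1)])
qed

lemma open_nhd_zero_avoiding_differences:
  fixes S :: "'a::topological_ab_group_add set"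
  assumes "closed S" "0 \<notin> S"
  obtains U where "open U" "0 \<in> U" "\<And>u v. u \<in> U \<Longrightarrow> v \<in> U \<Longrightarrow> u - v \<notin> S"
proof -
  have "open ((\<lambda>p::'a\<times>'a. fst p - snd p) -` (- S))"
    using assms(1) by (intro open_vimage continuous_intros) auto
  moreover have "(0, 0) \<in> (\<lambda>p::'a\<times>'a. fst p - snd p) -` (- S)" using assms(2) by simp
  ultimately obtain P Q where "open P" "open Q" "(0, 0) \<in> P \<times> Q"
    "P \<times> Q \<subseteq> (\<lambda>p::'a\<times>'a. fst p - snd p) -` (- S)"
    by (rule open_prod_elim)
  then show ?thesis by (intro that[of "P \<inter> Q"]) auto
qed

lemma continuous_on_translation: "continuous_on S (\<lambda>x::'a::topological_ab_group_add. x + c)"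
  by (intro continuous_intros)

lemma finite_borel_coloring:
  fixes S :: "'a::topological_ab_group_add set"
  assumes "compact (UNIV :: 'a set)" "closed S" "0 \<notin> S"
  obtains m and c :: "'a \<Rightarrow> nat"
  where "c \<in> borel \<rightarrow>\<^sub>M count_space UNIV" "\<And>x. c x < m" "\<And>x s. s \<in> S \<Longrightarrow> c (x + s) \<noteq> c x"
proof -
  obtain U where U: "open U" "0 \<in> U" "\<And>u v. u \<in> U \<Longrightarrow> v \<in> U \<Longrightarrow> u - v \<notin> S"
    using open_nhd_zero_avoiding_differences[OF assms(2,3)] by blast
  define V where "V y = (\<lambda>x. x + y) -` U" for y
  have openV: "open (V y)" for y
    unfolding V_def using U(1) by (intro open_vimage continuous_on_translation)
  have "x \<in> V (- x)" for x using U(2) by (simp add: V_def)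
  then have "UNIV \<subseteq> (\<Union>y\<in>UNIV. V y)" by blast
  with assms(1) openV obtain Y where Y: "finite Y" "UNIV \<subseteq> (\<Union>y\<in>Y. V y)"
    by (metis compactE_image)
  obtain ys where ys: "set ys = Y" using finite_list[OF Y(1)] by blast
  define c where "c x = (LEAST k. k < length ys \<and> x \<in> V (ys ! k))" for x
  have c: "c x < length ys \<and> x \<in> V (ys ! c x)" for x
  proof -
    obtain y where "y \<in> set ys" "x \<in> V y" using Y(2) ys by blast
    then have "\<exists>k. k < length ys \<and> x \<in> V (ys ! k)" by (auto simp: in_set_conv_nth)
    then show ?thesis unfolding c_def by (rule LeastI_ex)
  qed
  show ?thesis
  proof
    have [measurable]: "V y \<in> sets borel" for y using openV by (rule borel_open)
    show "c \<in> borel \<rightarrow>\<^sub>M count_space UNIV"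
      unfolding c_def by measurable
    show "c x < length ys" for x using c by blast
    show "c (x + s) \<noteq> c x" if "s \<in> S" for x s
    proof
      assume "c (x + s) = c x"
      then have "x + s + ys ! c x \<in> U" "x + ys ! c x \<in> U"
        using c[of x] c[of "x + s"] by (auto simp: V_def)
      from U(3)[OF this] that show False by (simp add: algebra_simps)
    qed
  qed
qed

lemma borel_coloring_inj_on_translates:
  fixes F :: "'a::{topological_ab_group_add,t2_space} set"
  assumes "compact (UNIV :: 'a set)" "finite F"
  obtains m and c :: "'a \<Rightarrow> nat"
  where "c \<in> borel \<rightarrow>\<^sub>M count_space UNIV" "range c \<subseteq> {..<m}" "\<And>x. inj_on (\<lambda>f. c (x - f)) F"
proof -
  define S where "S = (\<lambda>(f, f'). f - f') ` (F \<times> F) - {0}"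
  have "closed S" "0 \<notin> S" using assms(2) by (auto simp: S_def intro!: finite_imp_closed)
  then obtain m and c :: "'a \<Rightarrow> nat" where c: "c \<in> borel \<rightarrow>\<^sub>M count_space UNIV"
    "\<And>x. c x < m" "\<And>x s. s \<in> S \<Longrightarrow> c (x + s) \<noteq> c x"
    using finite_borel_coloring[OF assms(1)] by metis
  have "inj_on (\<lambda>f. c (x - f)) F" for x
  proof (rule inj_onI, rule ccontr)
    fix f f' assume f: "f \<in> F" "f' \<in> F" "c (x - f) = c (x - f')" "f \<noteq> f'"
    then have "f - f' \<in> S" by (force simp: S_def)
    from c(3)[OF this, of "x - f"] f(3) show False by (simp add: algebra_simps)
  qed
  with c(1,2) show ?thesis by (intro that) auto
qed

definition lowest_rank_set :: "('a::ab_group_add \<Rightarrow> nat) \<Rightarrow> 'a set \<Rightarrow> 'a set \<Rightarrow> 'a set" where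
  "lowest_rank_set r F I = {x. \<exists>i\<in>I. \<forall>f\<in>F. r (x - i) \<le> r (x - f)}"

lemma borel_lowest_rank_set:
  fixes r :: "'a::topological_ab_group_add \<Rightarrow> nat"
  assumes [measurable]: "r \<in> borel \<rightarrow>\<^sub>M count_space UNIV" and "finite F" "finite I"
  shows "lowest_rank_set r F I \<in> sets borel"
proof -
  have [measurable]: "(\<lambda>x::'a. x - c) \<in> borel \<rightarrow>\<^sub>M borel" for c
    by (intro borel_measurable_continuous_onI continuous_intros)
  have [measurable]: "(\<lambda>x. real (r (x - c))) \<in> borel_measurable borel" for c
    by measurable
  have "{x \<in> space borel. \<exists>i\<in>I. \<forall>f\<in>F. real (r (x - i)) \<le> real (r (x - f))} \<in> sets borel"
    using assms(2,3) by measurable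
  then show ?thesis by (simp add: lowest_rank_set_def)
qed

text \<open>Two points of the lowest rank set that differ by an element of \<open>D\<close> see the same lowest
  ranked point.\<close>

lemma avoiding_lowest_rank_set:
  assumes "I \<subseteq> F" and I: "avoiding D I"
    and nbr: "\<And>i d. i \<in> I \<Longrightarrow> d \<in> D \<Longrightarrow> i + d \<in> F \<and> i - d \<in> F"
    and inj: "\<And>x. inj_on (\<lambda>f. r (x - f)) F"
  shows "avoiding D (lowest_rank_set r F I)"
  unfolding avoiding_def
proof (intro ballI notI)
  fix x y assume xy: "x \<in> lowest_rank_set r F I" "y \<in> lowest_rank_set r F I" "x - y \<in> D"
  then obtain i j where i: "i \<in> I" "\<And>f. f \<in> F \<Longrightarrow> r (x - i) \<le> r (x - f)"
    and j: "j \<in> I" "\<And>f. f \<in> F \<Longrightarrow> r (y - j) \<le> r (y - f)"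
    by (auto simp: lowest_rank_set_def)
  have shifted: "j + (x - y) \<in> F" "i - (x - y) \<in> F"
    using nbr i(1) j(1) xy(3) by auto
  have "x - (j + (x - y)) = y - j" "y - (i - (x - y)) = x - i"
    by (simp_all add: algebra_simps)
  with i(2)[OF shifted(1)] j(2)[OF shifted(2)] have "r (x - i) = r (x - (j + (x - y)))" by simp
  then have "i = j + (x - y)"
    using inj_onD[OF inj[of x]] i(1) assms(1) shifted(1) by blast
  then have "i - j \<in> D" using xy(3) by simp
  then show False using I i(1) j(1) by (auto simp: avoiding_def)
qed

lemma card_permutations_lowest_rank_set:
  assumes "I \<subseteq> F" and inj: "inj_on (\<lambda>f. c (x - f)) F" and "range c \<subseteq> {..<m}"
  shows "card F * card {\<sigma>. \<sigma> permutes {..<m} \<and> x \<in> lowest_rank_set (\<sigma> \<circ> c) F I} = card I * fact m"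
proof -
  let ?c = "\<lambda>f. c (x - f)"
  have "{\<sigma>. \<sigma> permutes {..<m} \<and> x \<in> lowest_rank_set (\<sigma> \<circ> c) F I} =
      (\<Union>i\<in>?c ` I. argmin_permutations {..<m} (?c ` F) i)"
    by (auto simp: lowest_rank_set_def argmin_permutations_def)
  moreover have "card (?c ` F) = card F" "card (?c ` I) = card I"
    by (rule card_image[OF inj]) (rule card_image[OF inj_on_subset[OF inj assms(1)]])
  moreover have "?c ` F \<subseteq> {..<m}" using assms(3) by blast
  ultimately show ?thesis
    using card_UN_argmin_permutations[of "{..<m}" "?c ` F" "?c ` I"] assms(1)
    by (simp add: image_mono)
qed

locale haar_group =
  fixes \<mu> :: "'a::{topological_ab_group_add,t2_space} measure"
  assumes compact_UNIV: "compact (UNIV :: 'a set)"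
    and haar: "haar_prob \<mu>"
begin

sublocale prob_space \<mu>
  using haar by (simp add: haar_prob_def)

lemma sets_haar: "sets \<mu> = sets borel"
  using haar by (simp add: haar_prob_def)

lemma sets_translation:
  assumes "A \<in> sets borel"
  shows "{x::'a. x + c \<in> A} \<in> sets borel"
  using measurable_sets[OF borel_measurable_continuous_onI[OF continuous_on_translation] assms]
  by (simp add: vimage_def)

lemma prob_translation:
  assumes "A \<in> sets borel"
  shows "prob {x. x + c \<in> A} = prob A"
proof -
  have "{x. x + c \<in> A} = (\<lambda>y. - c + y) ` A"
    by (auto simp: image_iff intro!: bexI[of _ "_ + c"])
  moreover have "\<forall>x. \<forall>A\<in>sets borel. emeasure \<mu> ((\<lambda>y. x + y) ` A) = emeasure \<mu> A"
    using haar unfolding haar_prob_def by (elim conjE)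
  then have "emeasure \<mu> ((\<lambda>y. - c + y) ` A) = emeasure \<mu> A" using assms by blast
  ultimately show ?thesis by (simp only: measure_def)
qed

lemma prob_le_motzkin_density:
  assumes "A \<in> sets borel" "avoiding D A"
  shows "prob A \<le> motzkin_density \<mu> D"
  unfolding motzkin_density_def
proof (rule cSup_upper)
  show "bdd_above {prob A |A. A \<in> sets borel \<and> avoiding D A}"
    by (rule bdd_aboveI[of _ 1]) auto
qed (use assms in blast)

lemma motzkin_density_le:
  assumes "\<And>A. A \<in> sets borel \<Longrightarrow> avoiding D A \<Longrightarrow> prob A \<le> k"
  shows "motzkin_density \<mu> D \<le> k"
  unfolding motzkin_density_def
proof (rule cSup_least)
  have "{} \<in> sets (borel :: 'a measure)" "avoiding D {}" by (auto simp: avoiding_def)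
  then show "{prob A |A. A \<in> sets borel \<and> avoiding D A} \<noteq> {}" by blast
qed (use assms in auto)

lemma motzkin_density_nonneg: "0 \<le> motzkin_density \<mu> D"
  using prob_le_motzkin_density[of "{}" D] by (simp add: avoiding_def)

lemma card_mult_motzkin_density_le:
  fixes s :: "'b \<Rightarrow> 'a"
  assumes "finite J" and bound: "\<And>A. avoiding D A \<Longrightarrow> real (card {j\<in>J. s j \<in> A}) \<le> k"
  shows "real (card J) * motzkin_density \<mu> D \<le> k"
proof (cases "J = {}")
  case True
  then show ?thesis using bound[of "{}"] by (simp add: avoiding_def)
next
  case False
  then have pos: "0 < real (card J)" using assms(1) by (simp add: card_gt_0_iff)
  have "motzkin_density \<mu> D \<le> k / real (card J)"
  proof (rule motzkin_density_le)
    fix A :: "'a set" assume A: "A \<in> sets borel" "avoiding D A"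
    define B where "B j = {x. x + s j \<in> A}" for j
    have B: "B j \<in> events" for j
      using A(1) by (simp add: B_def sets_haar sets_translation)
    have "real (card {j\<in>J. x \<in> B j}) \<le> k" for x
    proof -
      have "avoiding D {y. x + y \<in> A}"
        using A(2) unfolding avoiding_def by (metis add_diff_cancel_left mem_Collect_eq)
      from bound[OF this] show ?thesis by (simp add: B_def)
    qed
    then have "(\<Sum>j\<in>J. prob (B j)) \<le> k"
      using B assms(1)
      by (simp add: sum_measure_eq_integral_card integrable_card_sets integral_le_const)
    then show "prob A \<le> k / real (card J)"
      using A(1) pos by (simp add: B_def prob_translation field_simps)
  qed
  then show ?thesis using pos by (simp add: field_simps)
qed

text \<open>If the colours of a proper colouring are ranked by a uniformly random permutation, then every
  point belongs to the lowest rank set with probability \<open>card I / card F\<close>.\<close>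

lemma card_le_card_mult_motzkin_density:
  fixes I F :: "'a set"
  assumes F: "finite F" "I \<subseteq> F" and I: "avoiding D I"
    and nbr: "\<And>i d. i \<in> I \<Longrightarrow> d \<in> D \<Longrightarrow> i + d \<in> F \<and> i - d \<in> F"
  shows "real (card I) \<le> real (card F) * motzkin_density \<mu> D"
proof -
  obtain m and c :: "'a \<Rightarrow> nat" where c: "c \<in> borel \<rightarrow>\<^sub>M count_space UNIV" "range c \<subseteq> {..<m}"
    and inj: "\<And>x. inj_on (\<lambda>f. c (x - f)) F"
    by (rule borel_coloring_inj_on_translates[OF compact_UNIV F(1)]) (rule that)
  define P where "P = {\<sigma>. \<sigma> permutes {..<m}}"
  have P: "finite P" "card P = fact m"
    by (simp_all add: P_def finite_permutations card_permutations)
  define A where "A \<sigma> = lowest_rank_set (\<sigma> \<circ> c) F I" for \<sigma>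
  have borel: "A \<sigma> \<in> sets borel" for \<sigma>
  proof -
    have "\<sigma> \<circ> c \<in> borel \<rightarrow>\<^sub>M count_space UNIV" by (rule measurable_comp[OF c(1)]) simp
    then show ?thesis
      unfolding A_def by (rule borel_lowest_rank_set[OF _ F(1) finite_subset[OF F(2,1)]])
  qed
  have avoiding: "avoiding D (A \<sigma>)" if "\<sigma> \<in> P" for \<sigma>
    unfolding A_def
  proof (rule avoiding_lowest_rank_set[OF F(2) I nbr])
    have "inj \<sigma>" using that by (auto simp: P_def intro: permutes_inj)
    then have "inj_on (\<sigma> \<circ> (\<lambda>f. c (x - f))) F" for x
      by (rule comp_inj_on[OF inj inj_on_subset[OF _ subset_UNIV]])
    then show "inj_on (\<lambda>f. (\<sigma> \<circ> c) (x - f)) F" for x by (simp add: o_def)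
  qed
  have "real (card F) * (\<Sum>\<sigma>\<in>P. prob (A \<sigma>)) =
      expectation (\<lambda>x. real (card F * card {\<sigma>\<in>P. x \<in> A \<sigma>}))"
    using borel P(1) by (simp add: sum_measure_eq_integral_card sets_haar)
  also have "\<dots> = real (card I) * fact m"
    using card_permutations_lowest_rank_set[OF F(2) inj c(2)]
    by (simp add: P_def A_def prob_space del: of_nat_mult) simp
  finally have "real (card I) * fact m = real (card F) * (\<Sum>\<sigma>\<in>P. prob (A \<sigma>))" ..
  also have "\<dots> \<le> real (card F) * (fact m * motzkin_density \<mu> D)"
    using sum_bounded_above[of P "\<lambda>\<sigma>. prob (A \<sigma>)" "motzkin_density \<mu> D"] borel avoiding P(2)
    by (intro mult_left_mono) (simp_all add: prob_le_motzkin_density)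
  finally show ?thesis by (simp add: mult.left_commute mult.commute)
qed

end

section \<open>Integer combinations and their relations\<close>

definition zmul :: "int \<Rightarrow> 'a::ab_group_add \<Rightarrow> 'a" where
  "zmul k x = (\<Sum>i<nat k. x) - (\<Sum>i<nat (- k). x)"

lemma zmul_succ: "zmul (k + 1) x = zmul k x + x"
proof (cases "0 \<le> k")
  case True
  then show ?thesis by (simp add: zmul_def nat_add_distrib)
next
  case False
  then have "nat (- k) = Suc (nat (- (k + 1)))" by simp
  then show ?thesis using False by (simp add: zmul_def)
qed

lemma zmul_add_left: "zmul (a + b) x = zmul a x + zmul b x"
proof (induction b rule: int_induct[where k = 0])
  case base
  then show ?case by (simp add: zmul_def)
next
  case (step1 i)
  then show ?case using zmul_succ[of "a + i" x] zmul_succ[of i x] by (simp add: algebra_simps)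
next
  case (step2 i)
  then show ?case
    using zmul_succ[of "a + (i - 1)" x] zmul_succ[of "i - 1" x] by (simp add: algebra_simps)
qed

interpretation zmul: module zmul
proof
  show "zmul a (x + y) = zmul a x + zmul a y" for a and x y :: 'a
    by (simp add: zmul_def sum.distrib)
  show one: "zmul 1 x = x" for x :: 'a
    by (simp add: zmul_def)
  show "zmul a (zmul b x) = zmul (a * b) x" for a b and x :: 'a
  proof (induction a rule: int_induct[where k = 0])
    case base
    then show ?case by (simp add: zmul_def)
  next
    case (step1 i)
    then show ?case by (simp add: zmul_add_left one distrib_right)
  next
    case (step2 i)
    then show ?case
      using zmul_add_left[of "i - 1" 1 "zmul b x"] zmul_add_left[of "(i - 1) * b" b x]
      by (simp add: one algebra_simps)
  qed
qed (rule zmul_add_left)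

definition int_comb :: "'a::ab_group_add set \<Rightarrow> ('a \<Rightarrow> int) \<Rightarrow> 'a" where
  "int_comb D c = (\<Sum>d\<in>D. zmul (c d) d)"

lemma int_comb_diff: "int_comb D (\<lambda>d. a d - b d) = int_comb D a - int_comb D b"
  by (simp add: int_comb_def zmul.scale_left_diff_distrib sum_subtractf)

lemma int_comb_scale: "int_comb D (\<lambda>d. k * c d) = zmul k (int_comb D c)"
  by (simp add: int_comb_def zmul.scale_sum_right)

lemma int_comb_cong: "(\<And>d. d \<in> D \<Longrightarrow> a d = b d) \<Longrightarrow> int_comb D a = int_comb D b"
  unfolding int_comb_def by (rule sum.cong) simp_all

lemma int_comb_fun_upd_add:
  assumes "finite D" "d \<in> D"
  shows "int_comb D (c(d := c d + k)) = int_comb D c + zmul k d"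
  using assms by (simp add: int_comb_def sum.remove zmul.scale_left_distrib add_ac)

lemma zmul_in_span_of_relation:
  assumes "finite D" "int_comb D c = 0" "x \<in> D" and zero: "\<And>y. y \<in> D \<Longrightarrow> y \<notin> {x, t} \<Longrightarrow> c y = 0"
  shows "zmul (c x) x \<in> zmul.span {t}"
proof -
  have "zmul (c y) y \<in> zmul.span {t}" if "y \<in> D - {x}" for y
    using that zero[of y]
    by (cases "y = t") (auto intro: zmul.span_base zmul.span_scale zmul.span_zero)
  then have "(\<Sum>y\<in>D - {x}. zmul (c y) y) \<in> zmul.span {t}" by (rule zmul.span_sum)
  moreover have "zmul (c x) x = - (\<Sum>y\<in>D - {x}. zmul (c y) y)"
    using assms(1-3) by (simp add: int_comb_def sum.remove eq_neg_iff_add_eq_0)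
  ultimately show ?thesis by (simp only: zmul.span_neg)
qed

definition int_combs :: "'a::ab_group_add set \<Rightarrow> int set \<Rightarrow> 'a set" where
  "int_combs D S = {int_comb D c | c. \<forall>d\<in>D. c d \<in> S}"

lemma int_combsI: "(\<And>d. d \<in> D \<Longrightarrow> c d \<in> S) \<Longrightarrow> int_comb D c \<in> int_combs D S"
  by (auto simp: int_combs_def)

lemma int_combs_eq_image: "int_combs D S = int_comb D ` (D \<rightarrow>\<^sub>E S)"
proof
  show "int_combs D S \<subseteq> int_comb D ` (D \<rightarrow>\<^sub>E S)"
  proof
    fix x assume "x \<in> int_combs D S"
    then obtain c where "x = int_comb D c" "\<forall>d\<in>D. c d \<in> S" by (auto simp: int_combs_def)
    then show "x \<in> int_comb D ` (D \<rightarrow>\<^sub>E S)"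
      by (intro image_eqI[of _ _ "restrict c D"]) (auto intro: int_comb_cong)
  qed
qed (auto intro: int_combsI)

lemma finite_int_combs: "finite D \<Longrightarrow> finite S \<Longrightarrow> finite (int_combs D S)"
  by (simp add: int_combs_eq_image finite_PiE)

lemma card_int_combs_le:
  assumes "finite D" "finite S"
  shows "card (int_combs D S) \<le> card S ^ card D"
proof -
  have "card (int_combs D S) \<le> card (D \<rightarrow>\<^sub>E S)"
    unfolding int_combs_eq_image using assms by (intro card_image_le finite_PiE)
  then show ?thesis using assms(1) by (simp add: card_PiE)
qed

lemma int_combs_mono: "S \<subseteq> T \<Longrightarrow> int_combs D S \<subseteq> int_combs D T"
  by (auto simp: int_combs_def)

lemma int_combs_neighbour:
  assumes "finite D" "d \<in> D" "x \<in> int_combs D {- int N..int N}"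
  shows "x + d \<in> int_combs D {- int (Suc N)..int (Suc N)}"
    and "x - d \<in> int_combs D {- int (Suc N)..int (Suc N)}"
proof -
  obtain c where c: "x = int_comb D c" "\<And>d. d \<in> D \<Longrightarrow> c d \<in> {- int N..int N}"
    using assms(3) by (auto simp: int_combs_def)
  have "x + zmul k d \<in> int_combs D {- int (Suc N)..int (Suc N)}" if "\<bar>k\<bar> \<le> 1" for k
    unfolding c(1) int_comb_fun_upd_add[OF assms(1,2), symmetric]
    using c(2) that by (intro int_combsI) fastforce
  from this[of 1] this[of "- 1"]
  show "x + d \<in> int_combs D {- int (Suc N)..int (Suc N)}"
    and "x - d \<in> int_combs D {- int (Suc N)..int (Suc N)}" by simp_all
qed

lemma polynomial_growth_int_combs:
  assumes "finite D"
  shows "(\<lambda>N. real (card (int_combs D {- int N..int N}))) \<in> O(\<lambda>N. real N ^ card D)"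
proof -
  have "real (card (int_combs D {- int N..int N})) \<le> (2 * real N + 1) ^ card D" for N
  proof -
    have "card (int_combs D {- int N..int N}) \<le> (2 * N + 1) ^ card D"
      using card_int_combs_le[OF assms, of "{- int N..int N}"]
      by (simp add: nat_add_distrib nat_mult_distrib)
    then have "real (card (int_combs D {- int N..int N})) \<le> real ((2 * N + 1) ^ card D)"
      by (simp only: of_nat_le_iff)
    then show ?thesis by (simp add: add.commute)
  qed
  then have "(\<lambda>N. real (card (int_combs D {- int N..int N}))) \<in> O(\<lambda>N. (2 * real N + 1) ^ card D)"
    by (intro bigoI[of _ 1]) simp
  also have "(\<lambda>N. (2 * real N + 1) ^ card D) \<in> O(\<lambda>N. real N ^ card D)"
    by (intro landau_o.big_power) real_asymp
  finally show ?thesis .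
qed

lemma le_of_polynomial_growth:
  fixes f :: "nat \<Rightarrow> real"
  assumes "0 < f 0" and growth: "f \<in> O(\<lambda>N. real N ^ k)"
    and step: "\<And>N. h * f N \<le> x * f (Suc N)" and "0 \<le> x"
  shows "h \<le> x"
proof (rule ccontr)
  assume "\<not> h \<le> x"
  then have h: "x < h" by simp
  have "x \<noteq> 0"
  proof
    assume "x = 0"
    with step[of 0] h assms(1) show False by (simp add: mult_le_0_iff)
  qed
  with assms(4) have x: "0 < x" by simp
  define r where "r = h / x"
  have r: "1 < r" using h x by (simp add: r_def)
  have "r ^ N * f 0 \<le> f N" for N
  proof (induction N)
    case (Suc N)
    have "r ^ Suc N * f 0 \<le> r * f N" using Suc r by simp
    also have "\<dots> \<le> f (Suc N)" using step[of N] x by (simp add: r_def field_simps)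
    finally show ?case .
  qed simp
  then have "(\<lambda>N. r ^ N) \<in> O(f)"
    using assms(1) r by (intro bigoI[of _ "1 / f 0"] always_eventually)
      (auto simp: field_simps intro: order.trans[OF _ abs_ge_self])
  also note growth
  also have "(\<lambda>N. real N ^ k) \<in> o(\<lambda>N. r ^ N)"
    using r by real_asymp
  finally show False using r by (simp add: landau_o.small_refl_iff)
qed

lemma ex_height_mod:
  assumes "finite D" and rel: "\<And>c. int_comb D c = 0 \<Longrightarrow> n dvd (\<Sum>d\<in>D. c d * h d)"
  obtains \<phi> :: "'a::ab_group_add \<Rightarrow> int"
  where "\<And>c d. d \<in> D \<Longrightarrow> [\<phi> (int_comb D c + d) = \<phi> (int_comb D c) + h d] (mod n)"
proof
  define coeff where "coeff x = (SOME c. int_comb D c = x)" for x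
  define \<phi> where "\<phi> x = (\<Sum>d\<in>D. coeff x d * h d)" for x
  have \<phi>: "[\<phi> (int_comb D c) = (\<Sum>d\<in>D. c d * h d)] (mod n)" for c
  proof -
    have "int_comb D (coeff (int_comb D c)) = int_comb D c"
      unfolding coeff_def by (rule someI[of _ c]) (rule refl)
    then have "int_comb D (\<lambda>d. coeff (int_comb D c) d - c d) = 0"
      by (simp add: int_comb_diff)
    from rel[OF this] show ?thesis
      by (simp add: \<phi>_def cong_iff_dvd_diff left_diff_distrib sum_subtractf)
  qed
  fix c d assume d: "d \<in> D"
  have "int_comb D c + d = int_comb D (c(d := c d + 1))"
    using int_comb_fun_upd_add[OF assms(1) d, of c 1] by simp
  moreover have "(\<Sum>e\<in>D. (c(d := c d + 1)) e * h e) = (\<Sum>e\<in>D. c e * h e) + h d"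
    using assms(1) d by (simp add: sum.remove distrib_right)
  ultimately have "[\<phi> (int_comb D c + d) = (\<Sum>e\<in>D. c e * h e) + h d] (mod n)"
    using \<phi>[of "c(d := c d + 1)"] by simp
  also have "[(\<Sum>e\<in>D. c e * h e) + h d = \<phi> (int_comb D c) + h d] (mod n)"
    by (intro cong_add cong_refl cong_sym[OF \<phi>])
  finally show "[\<phi> (int_comb D c + d) = \<phi> (int_comb D c) + h d] (mod n)" .
qed

lemma avoiding_residues:
  fixes \<phi> :: "'a::ab_group_add \<Rightarrow> int"
  assumes height: "\<And>y d. y \<in> F \<Longrightarrow> d \<in> D \<Longrightarrow> [\<phi> (y + d) = \<phi> y + h d] (mod n)"
    and avoid: "\<And>e e' d. e \<in> E \<Longrightarrow> e' \<in> E \<Longrightarrow> d \<in> D \<Longrightarrow> \<not> [e = e' + h d] (mod n)"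
  shows "avoiding D {x\<in>F. (\<phi> x + k) mod n \<in> E}"
  unfolding avoiding_def
proof (intro ballI notI)
  fix x y assume x: "x \<in> {x\<in>F. (\<phi> x + k) mod n \<in> E}" and y: "y \<in> {x\<in>F. (\<phi> x + k) mod n \<in> E}"
    and d: "x - y \<in> D"
  have "[\<phi> x = \<phi> y + h (x - y)] (mod n)" using height[of y "x - y"] y d by simp
  then have "[\<phi> x + k = \<phi> y + h (x - y) + k] (mod n)"
    by (rule cong_add[OF _ cong_refl])
  also have "\<phi> y + h (x - y) + k = (\<phi> y + k) + h (x - y)" by (simp only: add_ac)
  finally have "[(\<phi> x + k) mod n = (\<phi> y + k) mod n + h (x - y)] (mod n)"
    by (simp only: cong_def mod_simps mod_mod_trivial)
  with avoid x y d show False by blast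
qed

lemma card_mod_translate:
  fixes n :: int
  assumes "E \<subseteq> {0..<n}"
  shows "card {k\<in>{0..<n}. (p + k) mod n \<in> E} = card E"
proof (rule bij_betw_same_card)
  show "bij_betw (\<lambda>k. (p + k) mod n) {k\<in>{0..<n}. (p + k) mod n \<in> E} E"
    using assms by (intro bij_betw_byWitness[where f' = "\<lambda>e. (e - p) mod n"])
      (auto simp: mod_simps subset_iff)
qed

section \<open>Relations of rank at most one\<close>

definition proportional_relations :: "'a::ab_group_add set \<Rightarrow> bool" where
  "proportional_relations D \<longleftrightarrow> (\<forall>a b. int_comb D a = 0 \<longrightarrow> int_comb D b = 0 \<longrightarrow>
    (\<forall>d\<in>D. \<forall>e\<in>D. a d * b e = a e * b d))"

lemma ex_int_comb_walk:
  assumes "finite D" "(\<Sum>d\<in>D. \<bar>c d\<bar>) = int n"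
  shows "\<exists>s. s 0 = 0 \<and> s n = int_comb D c \<and>
    (\<forall>j<n. s (Suc j) - s j \<in> D \<or> s j - s (Suc j) \<in> D)"
  using assms(2)
proof (induction n arbitrary: c)
  case 0
  then have "\<forall>d\<in>D. c d = 0" using assms(1) by (simp add: sum_nonneg_eq_0_iff)
  then show ?case by (auto simp: int_comb_def intro!: exI[of _ "\<lambda>_. 0"])
next
  case (Suc n)
  then have "(\<Sum>d\<in>D. \<bar>c d\<bar>) \<noteq> 0" by simp
  then obtain d where d: "d \<in> D" "c d \<noteq> 0" by (metis abs_0 sum.neutral)
  define b where "b = c(d := c d + - sgn (c d))"
  have "\<bar>c d\<bar> = \<bar>b d\<bar> + 1" using d(2) by (auto simp: b_def sgn_if)
  then have "(\<Sum>d\<in>D. \<bar>b d\<bar>) = int n"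
    using Suc.prems assms(1) d(1) by (simp add: sum.remove[of D d] b_def)
  from Suc.IH[OF this] obtain s where s: "s 0 = 0" "s n = int_comb D b"
    "\<forall>j<n. s (Suc j) - s j \<in> D \<or> s j - s (Suc j) \<in> D" by blast
  have "int_comb D b = int_comb D c + zmul (- sgn (c d)) d"
    unfolding b_def by (rule int_comb_fun_upd_add[OF assms(1) d(1)])
  then have "int_comb D c - int_comb D b = d \<or> int_comb D b - int_comb D c = d"
    using d(2) by (simp add: sgn_if)
  with s d(1) show ?case
    by (intro exI[of _ "s(Suc n := int_comb D c)"]) (auto simp: less_Suc_eq)
qed

lemma abs_sum_proportional:
  fixes a b :: "'i \<Rightarrow> int"
  assumes proportional: "\<And>d e. d \<in> D \<Longrightarrow> e \<in> D \<Longrightarrow> a d * b e = a e * b d"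
    and "(\<Sum>d\<in>D. \<bar>a d\<bar>) \<noteq> 0" and sign: "\<And>d. d \<in> D \<Longrightarrow> a d * h d = \<bar>a d\<bar>"
  shows "(\<Sum>d\<in>D. \<bar>b d\<bar>) = \<bar>\<Sum>d\<in>D. b d * h d\<bar>"
proof -
  define n where "n = (\<Sum>d\<in>D. \<bar>a d\<bar>)"
  define S where "S = (\<Sum>d\<in>D. b d * h d)"
  have scaled: "n * b d = a d * S" if d: "d \<in> D" for d
  proof -
    have "n * b d = (\<Sum>e\<in>D. (a e * b d) * h e)"
      unfolding n_def sum_distrib_right by (rule sum.cong) (simp_all flip: sign)
    also have "\<dots> = (\<Sum>e\<in>D. (a d * b e) * h e)"
      using proportional d by (intro sum.cong) simp_all
    finally show ?thesis by (simp add: S_def sum_distrib_left mult.assoc)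
  qed
  have n: "0 \<le> n" "n \<noteq> 0" using assms(2) by (simp_all add: n_def sum_nonneg)
  have "n * (\<Sum>d\<in>D. \<bar>b d\<bar>) = (\<Sum>d\<in>D. \<bar>n * b d\<bar>)"
    using n(1) by (simp add: sum_distrib_left abs_mult)
  also have "\<dots> = (\<Sum>d\<in>D. \<bar>a d\<bar> * \<bar>S\<bar>)"
    by (intro sum.cong) (simp_all add: scaled abs_mult)
  also have "\<dots> = n * \<bar>S\<bar>" by (simp add: n_def sum_distrib_right)
  finally show ?thesis using n(2) by (simp add: S_def)
qed

text \<open>Reducing \<open>b\<close> modulo a shortest odd relation \<open>a\<close> leaves a relation of length \<open>s < n\<close> whose
  complement in \<open>a\<close> has length \<open>n - s\<close>, and one of these two lengths is odd.\<close>

lemma dvd_signed_sum_of_shortest_odd_relation: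
  assumes proportional: "proportional_relations D"
    and a: "int_comb D a = 0" "(\<Sum>d\<in>D. \<bar>a d\<bar>) = n" "odd n"
    and shortest: "\<And>c. int_comb D c = 0 \<Longrightarrow> odd (\<Sum>d\<in>D. \<bar>c d\<bar>) \<Longrightarrow> n \<le> (\<Sum>d\<in>D. \<bar>c d\<bar>)"
    and sign: "\<And>d. d \<in> D \<Longrightarrow> a d * h d = \<bar>a d\<bar>"
    and b: "int_comb D b = 0"
  shows "n dvd (\<Sum>d\<in>D. b d * h d)"
proof (rule ccontr)
  assume nd: "\<not> n dvd (\<Sum>d\<in>D. b d * h d)"
  define S where "S = (\<Sum>d\<in>D. b d * h d)"
  define s q where "s = S mod n" and "q = S div n"
  have length: "(\<Sum>d\<in>D. \<bar>c d\<bar>) = \<bar>\<Sum>d\<in>D. c d * h d\<bar>" if "int_comb D c = 0" for c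
    using proportional a that sign unfolding proportional_relations_def
    by (intro abs_sum_proportional[where a = a]) auto
  have n: "0 < n" using a(2,3) sum_nonneg[of D "\<lambda>d. \<bar>a d\<bar>"] by (cases "n = 0") auto
  then have s: "0 < s" "s < n"
    using nd pos_mod_bound[OF n, of S] pos_mod_sign[OF n, of S]
    by (auto simp: s_def S_def dvd_eq_mod_eq_0 order.strict_iff_order)
  define b' where "b' d = b d - q * a d" for d
  have rel: "int_comb D b' = 0" "int_comb D (\<lambda>d. a d - b' d) = 0"
    unfolding b'_def using a(1) b by (simp_all add: int_comb_diff int_comb_scale)
  have sum_a: "(\<Sum>d\<in>D. a d * h d) = n"
    unfolding a(2)[symmetric] by (rule sum.cong) (simp_all add: sign)
  have "(\<Sum>d\<in>D. b' d * h d) = S - q * n"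
    unfolding sum_a[symmetric]
    by (simp add: b'_def S_def left_diff_distrib sum_subtractf sum_distrib_left mult.assoc)
  then have sum_b': "(\<Sum>d\<in>D. b' d * h d) = s"
    by (simp add: s_def q_def minus_div_mult_eq_mod)
  then have "(\<Sum>d\<in>D. (a d - b' d) * h d) = n - s"
    by (simp add: left_diff_distrib sum_subtractf sum_a)
  then have "(\<Sum>d\<in>D. \<bar>b' d\<bar>) = s" "(\<Sum>d\<in>D. \<bar>a d - b' d\<bar>) = n - s"
    using length[OF rel(1)] length[OF rel(2)] sum_b' s by simp_all
  moreover have "odd s \<or> odd (n - s)" using a(3) by simp
  ultimately show False using shortest[OF rel(1)] shortest[OF rel(2)] s by auto
qed

context haar_group
begin

text \<open>The density does not drop when the group generated by \<open>D\<close> is mapped onto a cyclic group: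
  averaging the preimages of the translates of \<open>E\<close> over large balls loses only a boundary term.\<close>

lemma card_le_mult_motzkin_density_mod:
  fixes n :: nat and h :: "'a \<Rightarrow> int"
  assumes D: "finite D"
    and rel: "\<And>c. int_comb D c = 0 \<Longrightarrow> int n dvd (\<Sum>d\<in>D. c d * h d)"
    and E: "E \<subseteq> {0..<int n}"
    and avoid: "\<And>e e' d. e \<in> E \<Longrightarrow> e' \<in> E \<Longrightarrow> d \<in> D \<Longrightarrow> \<not> [e = e' + h d] (mod int n)"
  shows "real (card E) \<le> real n * motzkin_density \<mu> D"
proof (rule le_of_polynomial_growth)
  define F where "F N = int_combs D {- int N..int N}" for N
  obtain \<phi> where \<phi>: "\<And>c d. d \<in> D \<Longrightarrow> [\<phi> (int_comb D c + d) = \<phi> (int_comb D c) + h d] (mod int n)"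
    using ex_height_mod[OF D rel] by blast
  have finF: "finite (F N)" for N using D by (simp add: F_def finite_int_combs)
  have "int_comb D (\<lambda>_. 0) \<in> F 0" unfolding F_def by (rule int_combsI) simp
  then show "0 < real (card (F 0))" using finF[of 0] by (auto simp: card_gt_0_iff)
  show "(\<lambda>N. real (card (F N))) \<in> O(\<lambda>N. real N ^ card D)"
    unfolding F_def by (rule polynomial_growth_int_combs[OF D])
  fix N
  define I where "I k = {x \<in> F N. (\<phi> x + k) mod int n \<in> E}" for k
  have I: "real (card (I k)) \<le> real (card (F (Suc N))) * motzkin_density \<mu> D" for k
  proof (rule card_le_card_mult_motzkin_density[OF finF])
    show "I k \<subseteq> F (Suc N)"
      using int_combs_mono[of "{- int N..int N}" "{- int (Suc N)..int (Suc N)}" D]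
      by (auto simp: I_def F_def)
    have "[\<phi> (y + d) = \<phi> y + h d] (mod int n)" if "y \<in> F N" "d \<in> D" for y d
      using that \<phi> by (auto simp: F_def int_combs_def)
    then show "avoiding D (I k)"
      unfolding I_def using avoid by (rule avoiding_residues)
    show "x + d \<in> F (Suc N) \<and> x - d \<in> F (Suc N)" if "x \<in> I k" "d \<in> D" for x d
      using int_combs_neighbour[OF D] that by (auto simp: I_def F_def)
  qed
  have "(\<Sum>k\<in>{0..<int n}. card (I k)) = card E * card (F N)"
    unfolding I_def using finF card_mod_translate[OF E] by (intro sum_multicount) auto
  then have "real (card E) * real (card (F N)) = (\<Sum>k\<in>{0..<int n}. real (card (I k)))"
    by (simp flip: of_nat_mult of_nat_sum)
  also have "\<dots> \<le> (\<Sum>k\<in>{0..<int n}. real (card (F (Suc N))) * motzkin_density \<mu> D)"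
    by (intro sum_mono I)
  finally show "real (card E) * real (card (F N)) \<le>
      real n * motzkin_density \<mu> D * real (card (F (Suc N)))"
    by (simp add: mult_ac)
qed (simp add: motzkin_density_nonneg)

lemma motzkin_density_le_closed_walk:
  fixes s :: "nat \<Rightarrow> 'a"
  assumes "s n = s 0" and step: "\<And>j. j < n \<Longrightarrow> s (Suc j) - s j \<in> D \<or> s j - s (Suc j) \<in> D"
  shows "real n * motzkin_density \<mu> D \<le> real (n div 2)"
proof -
  have "real (card {j\<in>{..<n}. s j \<in> A}) \<le> real (n div 2)" if A: "avoiding D A" for A
  proof -
    define X where "X = {j\<in>{..<n}. s j \<in> A}"
    define succ where "succ j = (if Suc j = n then 0 else Suc j)" for j
    have s_succ: "s (succ j) = s (Suc j)" for j using assms(1) by (simp add: succ_def)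
    have "inj_on succ X" by (auto simp: inj_on_def succ_def split: if_splits)
    moreover have "s (succ j) \<notin> A" if "j \<in> X" for j
      using that A step[of j] by (auto simp: s_succ X_def avoiding_def)
    then have "succ ` X \<inter> X = {}" by (auto simp: X_def)
    ultimately have "2 * card X = card (succ ` X \<union> X)"
      by (simp add: card_Un_disjoint card_image X_def)
    also have "\<dots> \<le> card {..<n}"
      by (rule card_mono) (auto simp: X_def succ_def)
    finally show ?thesis by (simp add: X_def)
  qed
  from card_mult_motzkin_density_le[of "{..<n}" D s, OF _ this] show ?thesis by simp
qed

lemma motzkin_density_eq_cycle:
  fixes s :: "nat \<Rightarrow> 'a" and n :: nat
  assumes "finite D" "0 < n"
    and rel: "\<And>c. int_comb D c = 0 \<Longrightarrow> int n dvd (\<Sum>d\<in>D. c d * h d)"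
    and sign: "\<And>d. d \<in> D \<Longrightarrow> \<bar>h d\<bar> = 1"
    and walk: "s n = s 0" "\<And>j. j < n \<Longrightarrow> s (Suc j) - s j \<in> D \<or> s j - s (Suc j) \<in> D"
  shows "motzkin_density \<mu> D = real (n div 2) / real n"
proof -
  define E where "E = (\<lambda>j. 2 * int j) ` {..<n div 2}"
  have "card E = n div 2" by (simp add: E_def card_image inj_on_def)
  moreover have "real (card E) \<le> real n * motzkin_density \<mu> D"
  proof (rule card_le_mult_motzkin_density_mod[OF assms(1) rel])
    show "E \<subseteq> {0..<int n}" by (auto simp: E_def)
    fix e e' d assume e: "e \<in> E" "e' \<in> E" and "d \<in> D"
    have h: "h d = 1 \<or> h d = - 1" using sign[OF \<open>d \<in> D\<close>] by linarith
    have "odd (e - (e' + h d))" using e h by (auto simp: E_def)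
    moreover have "\<bar>e - (e' + h d)\<bar> < int n" using e h by (auto simp: E_def)
    ultimately show "\<not> [e = e' + h d] (mod int n)"
      by (metis cong_iff_dvd_diff dvd_imp_le_int even_zero linorder_not_less abs_of_nat)
  qed
  moreover have "real n * motzkin_density \<mu> D \<le> real (n div 2)"
    using walk by (rule motzkin_density_le_closed_walk)
  ultimately show ?thesis using assms(2) by (simp add: field_simps)
qed

lemma motzkin_density_even_relations:
  assumes "finite D" "D \<noteq> {}"
    and rel: "\<And>c. int_comb D c = 0 \<Longrightarrow> even (\<Sum>d\<in>D. c d)"
  shows "motzkin_density \<mu> D = 1 / 2"
proof -
  obtain d where "d \<in> D" using assms(2) by blast
  then have "motzkin_density \<mu> D = real (2 div 2) / real 2"
    using rel by (intro motzkin_density_eq_cycle[OF assms(1), where h = "\<lambda>_. 1"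
      and s = "\<lambda>j. if j = 1 then d else 0"]) (auto simp: less_2_cases_iff)
  then show ?thesis by simp
qed

lemma motzkin_density_odd_relation:
  assumes "finite D" "proportional_relations D" "int_comb D c = 0" "odd (\<Sum>d\<in>D. c d)"
  obtains n where "odd n" "motzkin_density \<mu> D = real (n div 2) / real n"
proof -
  define odd_relation where
    "odd_relation a \<longleftrightarrow> int_comb D a = 0 \<and> odd (\<Sum>d\<in>D. \<bar>a d\<bar>)" for a
  have "odd_relation c"
    using assms(1,3,4) unfolding odd_relation_def by (simp add: even_sum_iff)
  then obtain a where a: "odd_relation a"
    and shortest: "\<And>b. odd_relation b \<Longrightarrow> nat (\<Sum>d\<in>D. \<bar>a d\<bar>) \<le> nat (\<Sum>d\<in>D. \<bar>b d\<bar>)"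
    using ex_has_least_nat[of odd_relation c "\<lambda>a. nat (\<Sum>d\<in>D. \<bar>a d\<bar>)"] by blast
  define n where "n = nat (\<Sum>d\<in>D. \<bar>a d\<bar>)"
  have n: "(\<Sum>d\<in>D. \<bar>a d\<bar>) = int n" by (simp add: n_def sum_nonneg)
  define h where "h d = (if a d < 0 then - 1 else 1 :: int)" for d
  have dvd: "int n dvd (\<Sum>d\<in>D. b d * h d)" if "int_comb D b = 0" for b
  proof (rule dvd_signed_sum_of_shortest_odd_relation[OF assms(2) _ n _ _ _ that])
    show "int_comb D a = 0" "odd (int n)" using a n by (simp_all add: odd_relation_def)
    show "int n \<le> (\<Sum>d\<in>D. \<bar>b d\<bar>)" if "int_comb D b = 0" "odd (\<Sum>d\<in>D. \<bar>b d\<bar>)" for b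
      using shortest[of b] that by (simp add: odd_relation_def n_def nat_le_iff sum_nonneg)
    show "a d * h d = \<bar>a d\<bar>" for d by (simp add: h_def)
  qed
  obtain s where s: "s 0 = 0" "s n = int_comb D a"
    "\<forall>j<n. s (Suc j) - s j \<in> D \<or> s j - s (Suc j) \<in> D"
    using ex_int_comb_walk[OF assms(1) n] by blast
  have "odd n" using a n by (simp add: odd_relation_def)
  moreover have "motzkin_density \<mu> D = real (n div 2) / real n"
  proof (rule motzkin_density_eq_cycle[OF assms(1) _ dvd])
    show "0 < n" using \<open>odd n\<close> by (rule odd_pos)
    show "\<bar>h d\<bar> = 1" for d by (simp add: h_def)
    show "s n = s 0" using s(1,2) a by (simp add: odd_relation_def)
  qed (use s(3) in auto)
  ultimately show ?thesis by (rule that)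
qed

lemma motzkin_density_rational_proportional_relations:
  assumes "finite D" "D \<noteq> {}" "proportional_relations D"
  shows "motzkin_density \<mu> D \<in> \<rat>"
proof (cases "\<forall>c. int_comb D c = 0 \<longrightarrow> even (\<Sum>d\<in>D. c d)")
  case True
  then have "motzkin_density \<mu> D = 1 / 2"
    using assms(1,2) by (intro motzkin_density_even_relations) auto
  then show ?thesis by (simp only: Rats_divide Rats_1 Rats_number_of)
next
  case False
  then obtain n where "motzkin_density \<mu> D = real (n div 2) / real n"
    using motzkin_density_odd_relation[OF assms(1,3)] by blast
  then show ?thesis by (simp only: Rats_divide Rats_of_nat)
qed

end

section \<open>Maximal cycle means\<close>

definition walk :: "('v \<times> 'v) set \<Rightarrow> (nat \<Rightarrow> 'v) \<Rightarrow> nat \<Rightarrow> bool" where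
  "walk E r N \<longleftrightarrow> (\<forall>i<N. (r i, r (Suc i)) \<in> E)"

definition cycle_means :: "('v \<times> 'v) set \<Rightarrow> ('v \<Rightarrow> nat) \<Rightarrow> real set" where
  "cycle_means E w = {real (\<Sum>i<l. w (r i)) / real l | r l.
    0 < l \<and> l \<le> card (Domain E) \<and> walk E r l \<and> r l = r 0}"

definition max_cycle_mean :: "('v \<times> 'v) set \<Rightarrow> ('v \<Rightarrow> nat) \<Rightarrow> real" where
  "max_cycle_mean E w = Max (cycle_means E w)"

lemma walk_in_Domain: "walk E r N \<Longrightarrow> i < N \<Longrightarrow> r i \<in> Domain E"
  by (auto simp: walk_def)

lemma sum_walk_le:
  assumes "finite E" "walk E r N"
  shows "(\<Sum>i<N. w (r i)) \<le> N * Max (w ` Domain E)"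
proof -
  have "w (r i) \<le> Max (w ` Domain E)" if "i < N" for i
    using assms(1) walk_in_Domain[OF assms(2) that] by (simp add: finite_Domain)
  then show ?thesis using sum_bounded_above[of "{..<N}" "\<lambda>i. w (r i)"] by simp
qed

lemma finite_cycle_means:
  assumes "finite E"
  shows "finite (cycle_means E w)"
proof (rule finite_subset)
  let ?K = "card (Domain E)" and ?W = "Max (w ` Domain E)"
  show "cycle_means E w \<subseteq> (\<lambda>(a, b). real a / real b) ` ({..?K * ?W} \<times> {..?K})"
  proof
    fix x assume "x \<in> cycle_means E w"
    then obtain r l where rl: "l \<le> ?K" "walk E r l" "x = real (\<Sum>i<l. w (r i)) / real l"
      by (auto simp: cycle_means_def)
    have "(\<Sum>i<l. w (r i)) \<le> ?K * ?W"
      using sum_walk_le[OF assms rl(2)] rl(1) by (meson le_trans mult_le_mono1)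
    then show "x \<in> (\<lambda>(a, b). real a / real b) ` ({..?K * ?W} \<times> {..?K})"
      using rl by (intro image_eqI[of _ _ "(\<Sum>i<l. w (r i), l)"]) auto
  qed
qed simp

lemma cycle_means_nonempty:
  assumes "finite E" "(v, v) \<in> E"
  shows "cycle_means E w \<noteq> {}"
proof -
  have "Domain E \<noteq> {}" using assms(2) by blast
  then have "0 < card (Domain E)" using assms(1) by (simp add: card_gt_0_iff finite_Domain)
  then have "real (\<Sum>i<1::nat. w v) / real 1 \<in> cycle_means E w"
    unfolding cycle_means_def mem_Collect_eq using assms(2)
    by (intro exI[of _ "\<lambda>_. v"] exI[of _ 1]) (auto simp: walk_def)
  then show ?thesis by blast
qed

lemma ex_max_mean_cycle:
  assumes "finite E" "(v, v) \<in> E"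
  obtains r l where "0 < l" "walk E r l" "r l = r 0"
    "max_cycle_mean E w = real (\<Sum>i<l. w (r i)) / real l"
proof -
  have "max_cycle_mean E w \<in> cycle_means E w"
    unfolding max_cycle_mean_def
    by (rule Max_in[OF finite_cycle_means[OF assms(1)] cycle_means_nonempty[OF assms]])
  then show ?thesis unfolding cycle_means_def mem_Collect_eq by (elim exE conjE) (rule that)
qed

lemma max_cycle_mean_rational:
  assumes "finite E" "(v, v) \<in> E"
  shows "max_cycle_mean E w \<in> \<rat>"
  by (rule ex_max_mean_cycle[OF assms, of w]) (simp del: of_nat_sum)

lemma sum_cycle_le_max_cycle_mean:
  assumes "finite E" "l \<le> card (Domain E)" "walk E r l" "r l = r 0"
  shows "real (\<Sum>i<l. w (r i)) \<le> max_cycle_mean E w * real l"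
proof (cases "l = 0")
  case False
  then have "real (\<Sum>i<l. w (r i)) / real l \<in> cycle_means E w"
    using assms unfolding cycle_means_def by blast
  then have "real (\<Sum>i<l. w (r i)) / real l \<le> max_cycle_mean E w"
    unfolding max_cycle_mean_def using assms(1) by (intro Max_ge finite_cycle_means)
  then show ?thesis using False by (simp add: field_simps)
qed simp

lemma walk_periodic:
  assumes "0 < l" "walk E r l" "r l = r 0"
  shows "walk E (\<lambda>i. r (i mod l)) N"
  unfolding walk_def
proof (intro allI impI)
  fix i
  have "r (Suc i mod l) = r (Suc (i mod l))" using assms(3) by (simp add: mod_Suc)
  then show "(r (i mod l), r (Suc i mod l)) \<in> E"
    using assms(1,2) by (simp add: walk_def)
qed

lemma sum_periodic:
  fixes f :: "nat \<Rightarrow> nat"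
  shows "(\<Sum>i<q * l. f (i mod l)) = q * (\<Sum>i<l. f i)"
proof -
  have "(\<Sum>i<q * l. f (i mod l)) = (\<Sum>m<q. \<Sum>i\<in>{m * l..<m * l + l}. f (i mod l))"
    by (rule sum.nat_group[symmetric])
  also have "\<dots> = (\<Sum>m<q. \<Sum>i<l. f i)"
  proof (rule sum.cong[OF refl])
    show "(\<Sum>i\<in>{m * l..<m * l + l}. f (i mod l)) = (\<Sum>i<l. f i)" for m
      using sum.shift_bounds_nat_ivl[of "\<lambda>i. f (i mod l)" 0 "m * l" l]
      by (simp add: add.commute atLeast0LessThan)
  qed
  finally show ?thesis by simp
qed

lemma ex_max_mean_walk:
  assumes "finite E" "(v, v) \<in> E"
  obtains l s where "0 < l" "\<And>N. walk E s N"
    "\<And>q. real (\<Sum>i<q * l. w (s i)) = max_cycle_mean E w * real (q * l)"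
proof -
  obtain r l where r: "0 < l" "walk E r l" "r l = r 0"
    "max_cycle_mean E w = real (\<Sum>i<l. w (r i)) / real l"
    using ex_max_mean_cycle[OF assms] by blast
  show ?thesis
  proof (rule that[OF r(1) walk_periodic[OF r(1-3)]])
    show "real (\<Sum>i<q * l. w (r (i mod l))) = max_cycle_mean E w * real (q * l)" for q
      unfolding sum_periodic[of "\<lambda>i. w (r i)"] using r(1) by (simp add: r(4))
  qed
qed

definition excise :: "nat \<Rightarrow> nat \<Rightarrow> (nat \<Rightarrow> 'v) \<Rightarrow> nat \<Rightarrow> 'v" where
  "excise i p r k = (if k < i then r k else r (k + p))"

lemma walk_excise:
  assumes "walk E r (i + p + M)" "r (i + p) = r i"
  shows "walk E (excise i p r) (i + M)"
  unfolding walk_def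
proof (intro allI impI)
  fix k assume k: "k < i + M"
  have edge: "(r j, r (Suc j)) \<in> E" if "j < i + p + M" for j
    using assms(1) that by (simp add: walk_def)
  consider (before) "Suc k < i" | (junction) "Suc k = i" | (after) "i \<le> k" by linarith
  then show "(excise i p r k, excise i p r (Suc k)) \<in> E"
  proof cases
    case before
    then show ?thesis using edge[of k] by (simp add: excise_def)
  next
    case junction
    then have "excise i p r (Suc k) = r (Suc k)" using assms(2) by (auto simp: excise_def)
    then show ?thesis using junction edge[of k] by (simp add: excise_def)
  next
    case after
    then show ?thesis using k edge[of "k + p"] by (simp add: excise_def)
  qed
qed

lemma sum_excise:
  fixes w :: "'v \<Rightarrow> nat"
  shows "(\<Sum>k<i + p + M. w (r k)) =
    (\<Sum>k<i + M. w (excise i p r k)) + (\<Sum>k<p. w (r (i + k)))"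
proof (induction M)
  case 0
  have "(\<Sum>k<i + p. w (r k)) = (\<Sum>k<i. w (r k)) + (\<Sum>k<p. w (r (i + k)))"
    by (induction p) simp_all
  then show ?case by (simp add: excise_def)
next
  case (Suc M)
  then show ?case by (simp add: excise_def add_ac)
qed

lemma walk_repeats_vertex:
  assumes "finite E" "walk E r N" "card (Domain E) < N"
  obtains i p where "0 < p" "i + p \<le> card (Domain E)" "r (i + p) = r i"
proof -
  let ?K = "card (Domain E)"
  have "\<not> inj_on r {..?K}"
  proof
    assume "inj_on r {..?K}"
    moreover have "r ` {..?K} \<subseteq> Domain E" using assms(3) walk_in_Domain[OF assms(2)] by auto
    ultimately have "card {..?K} \<le> ?K" using assms(1) by (intro card_inj_on_le finite_Domain)
    then show False by simp
  qed
  then obtain i j where "i < j" "j \<le> ?K" "r j = r i"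
    unfolding inj_on_def by (metis atMost_iff linorder_neqE_nat)
  then show ?thesis using that[of "j - i" i] by simp
qed

lemma sum_walk_le_max_cycle_mean:
  fixes w :: "'v \<Rightarrow> nat"
  assumes E: "finite E" "(v, v) \<in> E" and "walk E r N"
  shows "real (\<Sum>i<N. w (r i)) \<le>
    max_cycle_mean E w * real N + real (card (Domain E) * Max (w ` Domain E))"
  using assms(3)
proof (induction N arbitrary: r rule: less_induct)
  case (less N)
  let ?\<rho> = "max_cycle_mean E w" and ?K = "card (Domain E)" and ?W = "Max (w ` Domain E)"
  show ?case
  proof (cases "N \<le> ?K")
    case True
    have "0 \<le> ?\<rho>" by (rule ex_max_mean_cycle[OF E, of w]) (simp add: sum_nonneg)
    moreover have "(\<Sum>i<N. w (r i)) \<le> ?K * ?W"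
      using sum_walk_le[OF E(1) less.prems] True by (meson le_trans mult_le_mono1)
    then have "real (\<Sum>i<N. w (r i)) \<le> real (?K * ?W)" by (simp only: of_nat_le_iff)
    ultimately show ?thesis by (smt (verit) mult_nonneg_nonneg of_nat_0_le_iff)
  next
    case False
    then have "?K < N" by simp
    then obtain i p where p: "0 < p" "i + p \<le> ?K" "r (i + p) = r i"
      by (rule walk_repeats_vertex[OF E(1) less.prems])
    define M where "M = N - (i + p)"
    have N: "N = i + p + M" using p(2) False by (simp add: M_def)
    have "walk E (\<lambda>k. r (i + k)) p" using less.prems by (simp add: walk_def N)
    then have cycle: "real (\<Sum>k<p. w (r (i + k))) \<le> ?\<rho> * real p"
      using p sum_cycle_le_max_cycle_mean[OF E(1), of p "\<lambda>k. r (i + k)" w] by simp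
    have "walk E (excise i p r) (i + M)"
      using less.prems p(3) by (intro walk_excise) (simp_all add: N)
    moreover have "i + M < N" using N p(1) by simp
    ultimately have IH: "real (\<Sum>k<i + M. w (excise i p r k)) \<le> ?\<rho> * real (i + M) + real (?K * ?W)"
      using less.IH by blast
    have "real (\<Sum>k<N. w (r k)) =
      real (\<Sum>k<i + M. w (excise i p r k)) + real (\<Sum>k<p. w (r (i + k)))"
      unfolding N sum_excise by (rule of_nat_add)
    also have "\<dots> \<le> ?\<rho> * real (i + M) + real (?K * ?W) + ?\<rho> * real p"
      using IH cycle by (rule add_mono)
    also have "\<dots> = ?\<rho> * real N + real (?K * ?W)" by (simp add: N algebra_simps)
    finally show ?thesis .
  qed
qed

section \<open>Virtually cyclic groups\<close>

locale block_tiling =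
  fixes D B :: "'a::ab_group_add set" and T :: 'a
  assumes finite_block: "finite B" and block_nonempty: "B \<noteq> {}"
    and block_unique: "\<And>b b' k k'. b \<in> B \<Longrightarrow> b' \<in> B \<Longrightarrow>
      b + zmul k T = b' + zmul k' T \<Longrightarrow> b = b' \<and> k = k'"
    and block_neighbour: "\<And>b d. b \<in> B \<Longrightarrow> d \<in> D \<union> uminus ` D \<Longrightarrow>
      \<exists>b'\<in>B. \<exists>k\<in>{-1, 0, 1}. b + d = b' + zmul k T"
begin

definition compatible :: "('a set \<times> 'a set) set" where
  "compatible = {(S, S'). S \<subseteq> B \<and> S' \<subseteq> B \<and> avoiding D (S \<union> (\<lambda>x. x + T) ` S')}"

definition stack :: "(nat \<Rightarrow> 'a set) \<Rightarrow> nat \<Rightarrow> 'a set" where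
  "stack s N = (\<lambda>(k, b). b + zmul (int k) T) ` (SIGMA k:{..<N}. s k)"

definition slab :: "nat \<Rightarrow> 'a set" where
  "slab N = (\<lambda>(k, b). b + zmul k T) ` ({-1..int N} \<times> B)"

lemma finite_compatible: "finite compatible"
  by (rule finite_subset[of _ "Pow B \<times> Pow B"]) (auto simp: compatible_def finite_block)

lemma empty_compatible: "({}, {}) \<in> compatible"
  by (simp add: compatible_def avoiding_def)

lemma compatible_slices:
  assumes "avoiding D A"
  shows "({b\<in>B. b + zmul (int k) T \<in> A}, {b\<in>B. b + zmul (int (Suc k)) T \<in> A}) \<in> compatible"
proof -
  let ?S = "{b\<in>B. b + zmul (int k) T \<in> A} \<union> (\<lambda>x. x + T) ` {b\<in>B. b + zmul (int (Suc k)) T \<in> A}"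
  have shift: "x + zmul (int k) T \<in> A" if "x \<in> ?S" for x
    using that by (auto simp: zmul.scale_left_distrib add_ac)
  have "x - y \<notin> D" if "x \<in> ?S" "y \<in> ?S" for x y
  proof -
    have "(x + zmul (int k) T) - (y + zmul (int k) T) \<notin> D"
      using shift[OF that(1)] shift[OF that(2)] assms unfolding avoiding_def by blast
    then show ?thesis by simp
  qed
  then show ?thesis by (auto simp: compatible_def avoiding_def)
qed

lemma walk_subset_block: "walk compatible s N \<Longrightarrow> k < N \<Longrightarrow> s k \<subseteq> B"
  by (auto simp: walk_def compatible_def)

lemma finite_slab: "finite (slab N)"
  by (simp add: slab_def finite_block)

lemma slabI: "b \<in> B \<Longrightarrow> -1 \<le> k \<Longrightarrow> k \<le> int N \<Longrightarrow> b + zmul k T \<in> slab N"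
  by (force simp: slab_def)

lemma card_slab: "card (slab N) = (N + 2) * card B"
proof -
  have "card (slab N) = card ({-1..int N} \<times> B)"
    unfolding slab_def by (rule card_image) (auto simp: inj_on_def dest: block_unique)
  then show ?thesis by (simp add: card_cartesian_product nat_add_distrib)
qed

lemma card_stack:
  assumes "walk compatible s N"
  shows "card (stack s N) = (\<Sum>k<N. card (s k))"
proof -
  note sB = walk_subset_block[OF assms]
  have "inj_on (\<lambda>(k, b). b + zmul (int k) T) (SIGMA k:{..<N}. s k)"
    using sB by (auto simp: inj_on_def subset_iff dest!: block_unique[rotated 2])
  then have "card (stack s N) = card (SIGMA k:{..<N}. s k)"
    unfolding stack_def by (rule card_image)
  moreover have "finite (s k)" if "k < N" for k
    using sB[OF that] finite_block by (rule finite_subset)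
  ultimately show ?thesis by simp
qed

lemma stack_subset_slab: "walk compatible s N \<Longrightarrow> stack s N \<subseteq> slab N"
  using walk_subset_block by (fastforce simp: stack_def intro!: slabI)

lemma stack_neighbour:
  assumes "walk compatible s N" "x \<in> stack s N" "d \<in> D \<union> uminus ` D"
  shows "x + d \<in> slab N"
proof -
  obtain k b where k: "x = b + zmul (int k) T" "b \<in> B" "k < N"
    using assms(2) walk_subset_block[OF assms(1)] by (auto simp: stack_def)
  obtain b' e where e: "b' \<in> B" "e \<in> {-1, 0, 1}" "b + d = b' + zmul e T"
    using block_neighbour[OF k(2) assms(3)] by blast
  have "x + d = (b + d) + zmul (int k) T" using k(1) by (simp add: add_ac)
  also have "\<dots> = b' + zmul (e + int k) T" by (simp add: e(3) zmul.scale_left_distrib add.assoc)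
  also have "\<dots> \<in> slab N" using e k by (intro slabI) auto
  finally show ?thesis .
qed

lemma block_level_difference:
  assumes "b \<in> B" "b' \<in> B" "(b + zmul k T) - (b' + zmul k' T) \<in> D"
  shows "k - k' \<in> {-1, 0, 1}"
proof -
  let ?d = "(b + zmul k T) - (b' + zmul k' T)"
  obtain b'' e where e: "b'' \<in> B" "e \<in> {-1, 0, 1}" "b' + ?d = b'' + zmul e T"
    using block_neighbour[OF assms(2)] assms(3) by blast
  have "b + zmul k T = (b' + ?d) + zmul k' T" by (simp add: algebra_simps)
  also have "\<dots> = b'' + zmul (e + k') T"
    by (simp only: e(3) zmul.scale_left_distrib add.assoc)
  finally have "k = e + k'" using block_unique[OF assms(1) e(1)] by blast
  with e(2) show ?thesis by simp
qed

lemma avoiding_stack: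
  assumes walk: "walk compatible s N"
  shows "avoiding D (stack s N)"
  unfolding avoiding_def
proof (intro ballI notI)
  fix x y assume xy: "x \<in> stack s N" "y \<in> stack s N" "x - y \<in> D"
  obtain k b where x: "x = b + zmul (int k) T" "b \<in> s k" "k < N"
    using xy(1) by (auto simp: stack_def)
  obtain k' b' where y: "y = b' + zmul (int k') T" "b' \<in> s k'" "k' < N"
    using xy(2) by (auto simp: stack_def)
  have no_difference: "u - v \<noteq> x - y"
    if "j < N" "u \<in> s j \<union> (\<lambda>x. x + T) ` s (Suc j)" "v \<in> s j \<union> (\<lambda>x. x + T) ` s (Suc j)" for u v j
  proof -
    have "avoiding D (s j \<union> (\<lambda>x. x + T) ` s (Suc j))"
      using walk that(1) by (simp add: walk_def compatible_def)
    then have "u - v \<notin> D" using that(2,3) unfolding avoiding_def by blast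
    then show ?thesis using xy(3) by auto
  qed
  have "b \<in> B" "b' \<in> B" using x(2,3) y(2,3) walk_subset_block[OF walk] by auto
  then have "int k - int k' \<in> {-1, 0, 1}"
    using xy(3) unfolding x(1) y(1) by (rule block_level_difference)
  then consider (same_level) "k = k'" | (above) "k = Suc k'" | (below) "k' = Suc k" by fastforce
  then show False
  proof cases
    case same_level
    then have "b - b' = x - y" using x(1) y(1) by simp
    then show False using no_difference[of k b b'] x(2,3) y(2) same_level by simp
  next
    case above
    then have "(b + T) - b' = x - y"
      using x(1) y(1) by (simp add: zmul.scale_left_distrib algebra_simps)
    then show False using no_difference[of k' "b + T" b'] x(2) y(2,3) above by blast
  next
    case below
    then have "b - (b' + T) = x - y"
      using x(1) y(1) by (simp add: zmul.scale_left_distrib algebra_simps)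
    then show False using no_difference[of k b "b' + T"] x(2,3) y(2) below by blast
  qed
qed

end

lemma nonpos_of_bounded_multiples:
  fixes y c :: real
  assumes "\<And>N :: nat. real N * y \<le> c"
  shows "y \<le> 0"
proof (rule ccontr)
  assume "\<not> y \<le> 0"
  then obtain N :: nat where "c < real N * y" using reals_Archimedean3[of y] by auto
  then show False using assms[of N] by simp
qed

lemma equivp_transversal:
  assumes "equivp R"
  obtains C' where "C' \<subseteq> C" "\<And>c. c \<in> C \<Longrightarrow> \<exists>c'\<in>C'. R c c'"
    "\<And>a b. a \<in> C' \<Longrightarrow> b \<in> C' \<Longrightarrow> R a b \<Longrightarrow> a = b"
proof
  define rep where "rep c = (SOME c'. c' \<in> C \<and> R c c')" for c
  have rep: "rep c \<in> C \<and> R c (rep c)" if "c \<in> C" for c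
    unfolding rep_def using that equivp_reflp[OF assms]
    by (intro someI[of "\<lambda>c'. c' \<in> C \<and> R c c'" c] conjI)
  then show "rep ` C \<subseteq> C" "\<And>c. c \<in> C \<Longrightarrow> \<exists>c'\<in>rep ` C. R c c'" by blast+
  fix a b assume "a \<in> rep ` C" "b \<in> rep ` C" "R a b"
  then obtain a' b' where ab: "a = rep a'" "b = rep b'" "a' \<in> C" "b' \<in> C" by blast
  then have "R a' b'"
    using rep[OF ab(3)] rep[OF ab(4)] \<open>R a b\<close> assms by (meson equivp_symp equivp_transp)
  then have "R a' = R b'" using assms by (simp add: equivp_def)
  then show "a = b" by (simp add: ab(1,2) rep_def)
qed

lemma finite_ex_int_bounded:
  assumes "finite S" "\<And>p. p \<in> S \<Longrightarrow> \<exists>k::int. P p k"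
  obtains M :: int where "0 < M" "\<And>p. p \<in> S \<Longrightarrow> \<exists>k. \<bar>k\<bar> < M \<and> P p k"
proof -
  obtain \<kappa> where \<kappa>: "\<And>p. p \<in> S \<Longrightarrow> P p (\<kappa> p)" using assms(2) by metis
  have "\<bar>\<kappa> p\<bar> \<le> (\<Sum>p\<in>S. \<bar>\<kappa> p\<bar>)" if "p \<in> S" for p
    using assms(1) that by (intro member_le_sum) auto
  then show ?thesis
    using \<kappa> by (intro that[of "1 + (\<Sum>p\<in>S. \<bar>\<kappa> p\<bar>)"]) (force simp: sum_nonneg add_pos_nonneg)+
qed

lemma int_div_in_unit_range:
  fixes k M :: int
  assumes "0 < M" "- M \<le> k" "k < 2 * M"
  shows "k div M \<in> {-1, 0, 1}"
proof -
  have "M * (k div M) = k - k mod M" by (rule minus_mod_eq_mult_div[symmetric])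
  moreover have "0 \<le> k mod M" "k mod M < M" using assms(1) by simp_all
  ultimately have "M * (- 1) < M * (k div M + 1)" "M * (k div M) < M * 2"
    using assms(2,3) unfolding distrib_left by linarith+
  then have "- 1 < k div M + 1" "k div M < 2"
    using assms(1) by (simp_all only: mult_less_cancel_left_pos)
  then show ?thesis by auto
qed

lemma block_tiling_of_bounded_shifts:
  fixes t :: "'a::ab_group_add"
  assumes C: "finite C" "C \<noteq> {}" and M: "0 < M"
    and nbr: "\<And>c d. c \<in> C \<Longrightarrow> d \<in> D \<union> uminus ` D \<Longrightarrow> \<exists>i. \<bar>i\<bar> < M \<and> c + d - zmul i t \<in> C"
    and unique: "\<And>a b. a \<in> C \<Longrightarrow> b \<in> C \<Longrightarrow> a - b \<in> zmul.span {t} \<Longrightarrow> a = b"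
    and torsion_free: "\<And>k. zmul k t = 0 \<Longrightarrow> k = 0"
  shows "block_tiling D ((\<lambda>(c, j). c + zmul j t) ` (C \<times> {0..<M})) (zmul M t)"
    (is "block_tiling D ?B _")
proof
  show "finite ?B" "?B \<noteq> {}" using C M by simp_all
next
  fix b b' k k' assume "b \<in> ?B" "b' \<in> ?B" and eq: "b + zmul k (zmul M t) = b' + zmul k' (zmul M t)"
  then obtain c j c' j' where b: "b = c + zmul j t" "c \<in> C" "0 \<le> j" "j < M"
    and b': "b' = c' + zmul j' t" "c' \<in> C" "0 \<le> j'" "j' < M" by auto
  have difference: "c - c' = zmul ((j' + k' * M) - (j + k * M)) t"
    using eq b(1) b'(1)
    by (simp add: zmul.scale_left_diff_distrib zmul.scale_left_distrib algebra_simps)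
  then have "c - c' \<in> zmul.span {t}" unfolding zmul.span_singleton by (rule range_eqI)
  then have "c = c'" by (rule unique[OF b(2) b'(2)])
  with difference have level: "j + k * M = j' + k' * M" using torsion_free by fastforce
  then have "(j + k * M) mod M = (j' + k' * M) mod M" by simp
  then have "j = j'" using b(3,4) b'(3,4) by simp
  then show "b = b' \<and> k = k'" using level M b(1) b'(1) \<open>c = c'\<close> by simp
next
  fix b d assume "b \<in> ?B" and d: "d \<in> D \<union> uminus ` D"
  then obtain c j where b: "b = c + zmul j t" "c \<in> C" "0 \<le> j" "j < M" by auto
  obtain i where i: "\<bar>i\<bar> < M" "c + d - zmul i t \<in> C" using nbr[OF b(2) d] by blast
  define k where "k = i + j"
  have "b + d = (c + d - zmul i t) + zmul k t"
    by (simp add: b(1) k_def zmul.scale_left_distrib algebra_simps)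
  also have "zmul k t = zmul (k mod M) t + zmul (k div M) (zmul M t)"
    by (simp flip: zmul.scale_left_distrib)
  finally have "b + d = (c + d - zmul i t + zmul (k mod M) t) + zmul (k div M) (zmul M t)"
    by (simp only: add.assoc)
  moreover have "c + d - zmul i t + zmul (k mod M) t \<in> ?B"
    using i(2) M by (intro image_eqI[of _ _ "(c + d - zmul i t, k mod M)"]) auto
  moreover have "k div M \<in> {-1, 0, 1}"
    using M i(1) b(3,4) by (intro int_div_in_unit_range) (simp_all add: k_def)
  ultimately show "\<exists>b'\<in>?B. \<exists>k\<in>{-1, 0, 1}. b + d = b' + zmul k (zmul M t)" by blast
qed

lemma block_tiling_of_transversal:
  fixes t :: "'a::ab_group_add"
  assumes fin: "finite D" "finite C" "C \<noteq> {}"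
    and nbr: "\<And>c d. c \<in> C \<Longrightarrow> d \<in> D \<union> uminus ` D \<Longrightarrow> \<exists>c'\<in>C. c + d - c' \<in> zmul.span {t}"
    and unique: "\<And>a b. a \<in> C \<Longrightarrow> b \<in> C \<Longrightarrow> a - b \<in> zmul.span {t} \<Longrightarrow> a = b"
    and torsion_free: "\<And>k. zmul k t = 0 \<Longrightarrow> k = 0"
  obtains B T where "block_tiling D B T"
proof -
  have "\<exists>i. fst p + snd p - zmul i t \<in> C" if p: "p \<in> C \<times> (D \<union> uminus ` D)" for p
  proof -
    obtain c i where "c \<in> C" "fst p + snd p - c = zmul i t"
      using nbr[of "fst p" "snd p"] p unfolding zmul.span_singleton mem_Times_iff by blast
    then have "fst p + snd p - zmul i t = c" by (simp add: algebra_simps)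
    then show ?thesis using \<open>c \<in> C\<close> by blast
  qed
  moreover have "finite (C \<times> (D \<union> uminus ` D))" using fin by simp
  ultimately obtain M where M: "0 < M"
    "\<And>p. p \<in> C \<times> (D \<union> uminus ` D) \<Longrightarrow> \<exists>i. \<bar>i\<bar> < M \<and> fst p + snd p - zmul i t \<in> C"
    using finite_ex_int_bounded[where P = "\<lambda>p i. fst p + snd p - zmul i t \<in> C"] by blast
  show ?thesis
  proof (rule that, rule block_tiling_of_bounded_shifts[OF fin(2,3) M(1) _ unique torsion_free])
    show "\<exists>i. \<bar>i\<bar> < M \<and> c + d - zmul i t \<in> C" if "c \<in> C" "d \<in> D \<union> uminus ` D" for c d
      using M(2)[of "(c, d)"] that by simp
  qed
qed

context haar_group
begin

lemma block_tiling_upper: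
  assumes "block_tiling D B T"
    and bound: "\<And>r. walk (block_tiling.compatible D B T) r N \<Longrightarrow> real (\<Sum>i<N. card (r i)) \<le> K"
  shows "real (N * card B) * motzkin_density \<mu> D \<le> K"
proof -
  interpret block_tiling D B T by fact
  let ?p = "\<lambda>(k, b). b + zmul (int k) T"
  have "real (card ({..<N} \<times> B)) * motzkin_density \<mu> D \<le> K"
  proof (rule card_mult_motzkin_density_le)
    fix A assume A: "avoiding D A"
    define r where "r k = {b \<in> B. b + zmul (int k) T \<in> A}" for k :: nat
    have "{j \<in> {..<N} \<times> B. ?p j \<in> A} = (SIGMA k:{..<N}. r k)"
      by (auto simp: r_def)
    then have "card {j \<in> {..<N} \<times> B. ?p j \<in> A} = (\<Sum>k<N. card (r k))"
      using finite_block by (simp add: r_def)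
    moreover have "walk compatible r N"
      using compatible_slices[OF A] by (simp add: walk_def r_def del: of_nat_Suc)
    ultimately show "real (card {j \<in> {..<N} \<times> B. ?p j \<in> A}) \<le> K"
      using bound by simp
  qed (use finite_block in simp)
  then show ?thesis by (simp add: card_cartesian_product)
qed

lemma block_tiling_lower:
  assumes "block_tiling D B T" "walk (block_tiling.compatible D B T) s N"
  shows "real (\<Sum>k<N. card (s k)) \<le> real ((N + 2) * card B) * motzkin_density \<mu> D"
proof -
  interpret block_tiling D B T by fact
  have "real (card (stack s N)) \<le> real (card (slab N)) * motzkin_density \<mu> D"
    using stack_neighbour[OF assms(2), of _ "- _"] stack_neighbour[OF assms(2)]
    by (intro card_le_card_mult_motzkin_density finite_slab stack_subset_slab avoiding_stack
        assms(2)) (metis UnCI imageI diff_conv_add_uminus)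
  then show ?thesis by (simp only: card_stack[OF assms(2)] card_slab)
qed

lemma motzkin_density_rational_block_tiling:
  assumes tiling: "block_tiling D B T"
  shows "motzkin_density \<mu> D \<in> \<rat>"
proof -
  interpret block_tiling D B T by (rule tiling)
  note graph = finite_compatible empty_compatible
  define \<rho> where "\<rho> = max_cycle_mean compatible card"
  define X where "X = real (card B) * motzkin_density \<mu> D"
  obtain c where "real (\<Sum>i<N. card (r i)) \<le> \<rho> * real N + c" if "walk compatible r N" for r N
    using sum_walk_le_max_cycle_mean[OF graph] unfolding \<rho>_def by blast
  then have "real N * X \<le> \<rho> * real N + c" for N
    using block_tiling_upper[OF tiling, of N "\<rho> * real N + c"] by (simp add: X_def mult.assoc)
  then have "X - \<rho> \<le> 0"
    by (intro nonpos_of_bounded_multiples[of _ c]) (simp add: algebra_simps)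
  obtain l s where l: "0 < l" and s: "\<And>N. walk compatible s N"
    and mean: "\<And>q. real (\<Sum>i<q * l. card (s i)) = \<rho> * real (q * l)"
    using ex_max_mean_walk[OF graph, of card] unfolding \<rho>_def by blast
  have "\<rho> * real (q * l) \<le> (real (q * l) + 2) * X" for q
    using block_tiling_lower[OF tiling s] unfolding mean[symmetric]
    by (rule order_trans) (simp add: X_def algebra_simps)
  then have "real l * (\<rho> - X) \<le> 0"
    by (intro nonpos_of_bounded_multiples[of _ "2 * X"]) (simp add: algebra_simps)
  then have "\<rho> - X \<le> 0" using l by (simp add: mult_le_0_iff)
  with \<open>X - \<rho> \<le> 0\<close> have "motzkin_density \<mu> D = \<rho> / real (card B)"
    using finite_block block_nonempty by (simp add: X_def field_simps)
  moreover have "\<rho> \<in> \<rat>" unfolding \<rho>_def by (rule max_cycle_mean_rational[OF graph])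
  ultimately show ?thesis by (simp only: Rats_divide Rats_of_nat)
qed

lemma motzkin_density_rational_finite:
  fixes F :: "'a set"
  assumes F: "finite F" "F \<noteq> {}" and nbr: "\<And>x d. x \<in> F \<Longrightarrow> d \<in> D \<union> uminus ` D \<Longrightarrow> x + d \<in> F"
  shows "motzkin_density \<mu> D \<in> \<rat>"
proof -
  have "\<exists>I. (I \<subseteq> F \<and> avoiding D I) \<and> (\<forall>J. J \<subseteq> F \<and> avoiding D J \<longrightarrow> card J \<le> card I)"
    by (rule ex_has_greatest_nat[of _ "{}" _ "Suc (card F)"])
      (auto simp: avoiding_def le_imp_less_Suc card_mono F(1))
  then obtain I where I: "I \<subseteq> F" "avoiding D I"
    and largest: "\<And>J. J \<subseteq> F \<Longrightarrow> avoiding D J \<Longrightarrow> card J \<le> card I" by blast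
  have "real (card I) \<le> real (card F) * motzkin_density \<mu> D"
  proof (rule card_le_card_mult_motzkin_density[OF F(1) I])
    show "i + d \<in> F \<and> i - d \<in> F" if "i \<in> I" "d \<in> D" for i d
      using I(1) nbr[of i d] nbr[of i "- d"] that by auto
  qed
  moreover have "real (card F) * motzkin_density \<mu> D \<le> real (card I)"
    using F(1) largest
    by (intro card_mult_motzkin_density_le[where s = "\<lambda>x. x"]) (auto simp: avoiding_def)
  moreover have "0 < card F" using F by (simp add: card_gt_0_iff)
  ultimately have "motzkin_density \<mu> D = real (card I) / real (card F)" by (simp add: field_simps)
  then show ?thesis by (simp only: Rats_divide Rats_of_nat)
qed

lemma motzkin_density_rational_torsion:
  assumes C: "finite C" "C \<noteq> {}" and m: "0 < m" "zmul m t = 0"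
    and nbr: "\<And>c d. c \<in> C \<Longrightarrow> d \<in> D \<union> uminus ` D \<Longrightarrow> \<exists>c'\<in>C. c + d - c' \<in> zmul.span {t}"
  shows "motzkin_density \<mu> D \<in> \<rat>"
proof (rule motzkin_density_rational_finite)
  let ?F = "(\<lambda>(c, k). c + zmul k t) ` (C \<times> {0..<m})"
  show "finite ?F" "?F \<noteq> {}" using C m(1) by simp_all
  have reduce: "zmul (k mod m) t = zmul k t" for k
  proof -
    have "zmul k t = zmul (k div m * m) t + zmul (k mod m) t"
      by (simp flip: zmul.scale_left_distrib)
    also have "zmul (k div m * m) t = zmul (k div m) (zmul m t)" by simp
    finally show ?thesis by (simp only: m(2) zmul.scale_zero_right add_0)
  qed
  fix x d assume "x \<in> ?F" and d: "d \<in> D \<union> uminus ` D"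
  then obtain c k where c: "c \<in> C" "x = c + zmul k t" by auto
  obtain c' j where j: "c' \<in> C" "c + d - c' = zmul j t"
    using nbr[OF c(1) d] unfolding zmul.span_singleton by blast
  have "x + d = c' + (c + d - c') + zmul k t" using c(2) by (simp add: add_ac)
  also have "\<dots> = c' + zmul ((j + k) mod m) t"
    by (simp only: j(2) reduce zmul.scale_left_distrib add.assoc)
  finally show "x + d \<in> ?F"
    using j(1) m(1) by (intro image_eqI[of _ _ "(c', (j + k) mod m)"]) auto
qed

lemma motzkin_density_rational_virtually_cyclic:
  fixes C :: "'a set" and t :: 'a
  assumes "finite D" "finite C" "C \<noteq> {}"
    and nbr: "\<And>c d. c \<in> C \<Longrightarrow> d \<in> D \<union> uminus ` D \<Longrightarrow> \<exists>c'\<in>C. c + d - c' \<in> zmul.span {t}"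
  shows "motzkin_density \<mu> D \<in> \<rat>"
proof (cases "\<exists>m>0. zmul m t = 0")
  case True
  then obtain m where "0 < m" "zmul m t = 0" by blast
  from motzkin_density_rational_torsion[OF assms(2,3) this nbr] show ?thesis .
next
  case False
  then have torsion_free: "k = 0" if "zmul k t = 0" for k
    using that zmul.scale_minus_left[of k t]
    by (metis neg_0_less_iff_less linorder_neqE neg_equal_0_iff_equal)
  define R where "R x y \<longleftrightarrow> x - y \<in> zmul.span {t}" for x y
  have R_trans: "R x z" if "R x y" "R y z" for x y z
    using zmul.span_add that unfolding R_def by fastforce
  have "equivp R"
  proof (rule equivpI)
    show "reflp R" by (simp add: R_def reflp_def zmul.span_zero)
    show "symp R" using zmul.span_neg unfolding R_def symp_def by fastforce
    show "transp R" using R_trans by (rule transpI)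
  qed
  then obtain C' where C': "C' \<subseteq> C" "\<And>c. c \<in> C \<Longrightarrow> \<exists>c'\<in>C'. R c c'"
    "\<And>a b. a \<in> C' \<Longrightarrow> b \<in> C' \<Longrightarrow> R a b \<Longrightarrow> a = b"
    using equivp_transversal by blast
  have "finite C'" using C'(1) assms(2) by (rule finite_subset)
  moreover have "C' \<noteq> {}" using C'(2) assms(3) by blast
  moreover have "\<exists>c'\<in>C'. R (c + d) c'" if "c \<in> C'" "d \<in> D \<union> uminus ` D" for c d
    using nbr[folded R_def] that C'(1,2) R_trans by (meson subsetD)
  ultimately obtain B T where "block_tiling D B T"
    using block_tiling_of_transversal[OF assms(1)] C'(3) torsion_free unfolding R_def by metis
  then show ?thesis by (rule motzkin_density_rational_block_tiling)
qed

lemma motzkin_density_rational_of_multiples: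
  assumes D: "finite D" and M: "0 < M"
    and multiple: "\<And>d. d \<in> D \<Longrightarrow> zmul M d \<in> zmul.span {t}"
  shows "motzkin_density \<mu> D \<in> \<rat>"
proof (rule motzkin_density_rational_virtually_cyclic[OF D, where C = "int_combs D {0..<M}"])
  have reduce: "\<exists>c'\<in>int_combs D {0..<M}. int_comb D c - c' \<in> zmul.span {t}" for c
  proof
    show "int_comb D (\<lambda>d. c d mod M) \<in> int_combs D {0..<M}"
      using M by (intro int_combsI) simp
    have "int_comb D c - int_comb D (\<lambda>d. c d mod M) = (\<Sum>d\<in>D. zmul (c d div M) (zmul M d))"
      unfolding int_comb_diff[symmetric] by (simp add: int_comb_def minus_mod_eq_div_mult)
    then show "int_comb D c - int_comb D (\<lambda>d. c d mod M) \<in> zmul.span {t}"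
      by (simp only: zmul.span_sum zmul.span_scale multiple)
  qed
  show "finite (int_combs D {0..<M})" using D by (simp add: finite_int_combs)
  show "int_combs D {0..<M} \<noteq> {}" using reduce[of "\<lambda>_. 0"] by blast
  fix x d assume "x \<in> int_combs D {0..<M}" and d: "d \<in> D \<union> uminus ` D"
  then obtain c where c: "x = int_comb D c" by (auto simp: int_combs_def)
  obtain e k where "e \<in> D" "d = zmul k e"
  proof -
    from d consider "d \<in> D" | "- d \<in> D" by auto
    then show ?thesis
      by cases (use that[of d 1] that[of "- d" "- 1"] in auto)
  qed
  then have "x + d = int_comb D (c(e := c e + k))"
    using D c by (simp add: int_comb_fun_upd_add)
  then show "\<exists>c'\<in>int_combs D {0..<M}. x + d - c' \<in> zmul.span {t}" using reduce by simp
qed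

lemma motzkin_density_rational_not_proportional:
  assumes "finite D" "card D \<le> 3" "\<not> proportional_relations D"
  shows "motzkin_density \<mu> D \<in> \<rat>"
proof -
  obtain a b d e where rel: "int_comb D a = 0" "int_comb D b = 0" and de: "d \<in> D" "e \<in> D"
    and "a d * b e \<noteq> a e * b d"
    using assms(3) unfolding proportional_relations_def by blast
  define m where "m = a d * b e - a e * b d"
  have m: "m \<noteq> 0" "d \<noteq> e" using \<open>a d * b e \<noteq> a e * b d\<close> by (auto simp: m_def)
  have "card (D - {d, e}) \<le> Suc 0"
    using assms(1,2) de m(2) by (simp add: card_Diff_subset)
  then have "\<forall>x\<in>D - {d, e}. \<forall>y\<in>D - {d, e}. x = y"
    using assms(1) by (simp only: card_le_Suc0_iff_eq finite_Diff)
  then obtain t where t: "D \<subseteq> {d, e, t}" by blast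
  have eliminated: "int_comb D (\<lambda>x. j * a x - k * b x) = 0" for j k
    by (simp add: int_comb_diff int_comb_scale rel)
  have "zmul m d \<in> zmul.span {t}"
    using zmul_in_span_of_relation[OF assms(1) eliminated[of "b e" "a e"] de(1)] t
    by (auto simp: m_def mult.commute)
  moreover have "zmul m e \<in> zmul.span {t}"
    using zmul_in_span_of_relation[OF assms(1) eliminated[of "- b d" "- a d"] de(2)] t
    by (auto simp: m_def mult.commute)
  ultimately have "zmul m x \<in> zmul.span {t}" if "x \<in> D" for x
    using t that by (auto intro: zmul.span_base zmul.span_scale)
  then have "zmul \<bar>m\<bar> x \<in> zmul.span {t}" if "x \<in> D" for x
    using that by (simp add: abs_if zmul.span_neg)
  then show ?thesis
    using m(1) by (intro motzkin_density_rational_of_multiples[OF assms(1), of "\<bar>m\<bar>" t]) auto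
qed

end

theorem theorem1p1:
  fixes \<mu> :: "'a::{topological_ab_group_add,t2_space} measure"
    and D :: "'a set"
  assumes "compact (UNIV :: 'a set)"
    and "haar_prob \<mu>"
    and "finite D" and "0 \<notin> D" and "card D \<le> 3"
  shows "motzkin_density \<mu> D \<in> \<rat>"
proof -
  interpret haar_group \<mu> using assms(1,2) by unfold_locales
  consider (empty) "D = {}" | (proportional) "D \<noteq> {}" "proportional_relations D"
    | (not_proportional) "\<not> proportional_relations D" by blast
  then show ?thesis
  proof cases
    case empty
    then show ?thesis using motzkin_density_rational_finite[of "{0}" D] by simp
  next
    case proportional
    with assms(3) show ?thesis by (rule motzkin_density_rational_proportional_relations)
  next
    case not_proportional
    with assms(3,5) show ?thesis by (rule motzkin_density_rational_not_proportional)
  qed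
qed

end
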